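(* Let $(\mathcal B,\langle\!\langle-\rangle\!\rangle,\mathcal T)$ be a $\mathcal T$-shadowed bicategory equipped with $G$-twisting data, and let $g\in G$. The induced $g$-twisted shadow functors ${}^g\langle\!\langle-\rangle\!\rangle_R\colon\mathcal B^{G\text{-tw}}(R,R)\to\mathcal T$ admit natural isomorphisms $${}^g\theta_{M,N}\colon{}^g\langle\!\langle M\odot N\rangle\!\rangle_R\xrightarrow{\cong}{}^g\langle\!\langle N\odot M\rangle\!\rangle_S$$ for 1-cells $(M,\tau)\colon R\to S$ and $(N,\sigma)\colon S\to R$ in $\mathcal B^{G\text{-tw}}$ (the twisted cyclic isomorphisms), such that: (1) (Twisted hexagon) for 1-cells $(M,\tau)\colon R\to S$, $(N,\sigma)\colon S\to T$, $(P,\omega)\colon T\to R$, the composite $${}^g\langle\!\langle(M\odot N)\odot P\rangle\!\rangle_R\xrightarrow{{}^g\theta_{M\odot N,P}}{}^g\langle\!\langle P\odot(M\odot N)\rangle\!\rangle_T\cong{}^g\langle\!\langle(P\odot M)\odot N\rangle\!\rangle_T\xrightarrow{{}^g\theta_{P\odot M,N}}{}^g\langle\!\langle N\odot(P\odot M)\rangle\!\rangle_S$$ equals the composite $${}^g\langle\!\langle(M\odot N)\odot P\rangle\!\rangle_R\cong{}^g\langle\!\langle M\odot(N\odot P)\rangle\!\rangle_R\xrightarrow{{}^g\theta_{M,N\odot P}}{}^g\langle\!\langle(N\odot P)\odot M\rangle\!\rangle_S\cong{}^g\langle\!\langle N\odot(P\odot M)\rangle\!\rangle_S,$$ where the unlabelled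 isomorphisms are induced by the associator; (2) (Twisted triangle) for every 1-cell $(M,\tau)\colon R\to R$, ${}^g\langle\!\langle\mathfrak l\rangle\!\rangle\circ{}^g\theta_{M,U_R}={}^g\langle\!\langle\mathfrak r\rangle\!\rangle\colon{}^g\langle\!\langle M\odot U_R\rangle\!\rangle_R\to{}^g\langle\!\langle M\rangle\!\rangle_R$.
   Context: **Bicategories.** For 1-cells $M\colon A\to B$, $N\colon B\to C$ the horizontal composite is written $M\odot N\colon A\to C$ (first $M$, then $N$); $U_A$ is the unit 1-cell; $\mathfrak a,\mathfrak l,\mathfrak r$ are the associator and the left and right unitors (suppressed where harmless). $\mathrm{Pic}_{\mathcal B}(A)$ is the monoidal groupoid (under $\odot$) of invertible 1-cells $A\to A$ and invertible 2-cells. **$G$-twisting data** ($G$ a group): for each 0-cell $A$ a strong monoidal functor $\Theta_A\colon G\to\mathrm{Pic}_{\mathcal B}(A)$ with structure 2-cells $\mu^A_{g,h}\colon\Theta_A(g)\odot\Theta_A(h)\Rightarrow\Theta_A(gh)$, $\eta^A\colon U_A\Rightarrow\Theta_A(e)$. For $M\colon A\to B$: ${}^gM=\Theta_A(g^{-1})\odot M$, $M^g=M\odot\Theta_B(g)$; ${}^gf=\mathrm{id}\odot f$ for a 2-cell $f$. **Bicategory of $G$-twists $\mathcal B^{G\text{-tw}}$.** Same 0-cells. A 1-cell $A\to B$ is $(M,\tau)$ with $M\colon A\to B$ in $\mathcal B$ and invertible 2-cells $\tau_g\colon\Theta_A(g)\odot M\Rightarrow M\odot\Theta_B(g)$, $g\in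 G$, such that $M\cong U_A\odot M\xrightarrow{\eta^A}\Theta_A(e)\odot M\xrightarrow{\tau_e}M\odot\Theta_B(e)\xrightarrow{(\eta^B)^{-1}}M\odot U_B\cong M$ is the identity and $\tau_{gh}=(\mathrm{id}_M\odot\mu^B_{g,h})(\tau_g\odot\mathrm{id})(\mathrm{id}\odot\tau_h)((\mu^A_{g,h})^{-1}\odot\mathrm{id}_M)$. A 2-cell $(M,\tau)\Rightarrow(N,\sigma)$ is a 2-cell $f\colon M\Rightarrow N$ with $\sigma_g(\mathrm{id}\odot f)=(f\odot\mathrm{id})\tau_g$ for all $g$. Composite: $(M\odot N,\tau\star\sigma)$, $(\tau\star\sigma)_g=(\mathrm{id}_M\odot\sigma_g)(\tau_g\odot\mathrm{id}_N)$. Unit: $U_A$ with $\tau^U_g=\mathfrak l^{-1}\mathfrak r$. Associators and unitors are those of $\mathcal B$. **Shadows.** A $\mathcal T$-shadow on $\mathcal B$ ("$\mathcal T$-shadowed bicategory") is a family of functors $\langle\!\langle-\rangle\!\rangle_R\colon\mathcal B(R,R)\to\mathcal T$ with natural isomorphisms $\theta_{M,N}\colon\langle\!\langle M\odot N\rangle\!\rangle_R\cong\langle\!\langle N\odot M\rangle\!\rangle_S$ ($M\colon R\to S$, $N\colon S\to R$) such that, up to associators, $\theta_{M\odot N,P}=\theta_{N,P\odot M}\circ\theta_{M,N\odot P}$, and $\langle\!\langle\mathfrak l\rangle\!\rangle\circ\theta_{M,U_R}=\langle\!\langle\mathfrak r\rangle\!\rangle$, $\langle\!\langle\mathfrak r\rangle\!\rangle\circ\theta_{U_R,M}=\langle\!\langle\mathfrak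 l\rangle\!\rangle$. **Induced $g$-twisted shadow functor.** ${}^g\langle\!\langle(M,\tau)\rangle\!\rangle_R=\langle\!\langle{}^gM\rangle\!\rangle_R$ and ${}^g\langle\!\langle f\rangle\!\rangle_R=\langle\!\langle{}^gf\rangle\!\rangle_R$. *)

theory Defs
  imports "HOL-Algebra.Group"
begin

text \<open>
  Composition and identities do not depend on the hom-set, and the hom-sets are not required to be
  disjoint. Every category is isomorphic to one of this form, and a 2-cell between two twisted
  1-cells below can literally be a 2-cell between the underlying 1-cells.
\<close>

record ('o, 'a) cat =
  Ob :: "'o set"
  Hom :: "'o \<Rightarrow> 'o \<Rightarrow> 'a set"
  Id :: "'o \<Rightarrow> 'a"
  Comp :: "'a \<Rightarrow> 'a \<Rightarrow> 'a" (infixr "\<cdot>\<index>" 55)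

locale category =
  fixes C :: "('o, 'a, 'z) cat_scheme" (structure)
  assumes Id_hom: "x \<in> Ob C \<Longrightarrow> Id C x \<in> Hom C x x"
    and Comp_hom: "\<lbrakk>x \<in> Ob C; y \<in> Ob C; z \<in> Ob C; f \<in> Hom C x y; h \<in> Hom C y z\<rbrakk>
      \<Longrightarrow> h \<cdot> f \<in> Hom C x z"
    and Id_left: "\<lbrakk>x \<in> Ob C; y \<in> Ob C; f \<in> Hom C x y\<rbrakk> \<Longrightarrow> Id C y \<cdot> f = f"
    and Id_right: "\<lbrakk>x \<in> Ob C; y \<in> Ob C; f \<in> Hom C x y\<rbrakk> \<Longrightarrow> f \<cdot> Id C x = f"
    and Comp_assoc: "\<lbrakk>w \<in> Ob C; x \<in> Ob C; y \<in> Ob C; z \<in> Ob C;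
        f \<in> Hom C w x; h \<in> Hom C x y; k \<in> Hom C y z\<rbrakk>
      \<Longrightarrow> (k \<cdot> h) \<cdot> f = k \<cdot> (h \<cdot> f)"

definition inverse_arrows :: "('o, 'a, 'z) cat_scheme \<Rightarrow> 'o \<Rightarrow> 'o \<Rightarrow> 'a \<Rightarrow> 'a \<Rightarrow> bool" where
  "inverse_arrows C x y f h \<longleftrightarrow> f \<in> Hom C x y \<and> h \<in> Hom C y x \<and>
     h \<cdot>\<^bsub>C\<^esub> f = Id C x \<and> f \<cdot>\<^bsub>C\<^esub> h = Id C y"

definition Iso :: "('o, 'a, 'z) cat_scheme \<Rightarrow> 'o \<Rightarrow> 'o \<Rightarrow> 'a set" where
  "Iso C x y = {f. \<exists>h. inverse_arrows C x y f h}"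

definition Inv :: "('o, 'a, 'z) cat_scheme \<Rightarrow> 'o \<Rightarrow> 'o \<Rightarrow> 'a \<Rightarrow> 'a" where
  "Inv C x y f = (THE h. inverse_arrows C x y f h)"

definition prod_cat ::
  "('o, 'a, 'y) cat_scheme \<Rightarrow> ('p, 'b, 'z) cat_scheme \<Rightarrow> ('o \<times> 'p, 'a \<times> 'b) cat" where
  "prod_cat C D = \<lparr>Ob = Ob C \<times> Ob D,
     Hom = (\<lambda>(x, u) (y, v). Hom C x y \<times> Hom D u v),
     Id = (\<lambda>(x, u). (Id C x, Id D u)),
     Comp = (\<lambda>(f, h) (f', h'). (f \<cdot>\<^bsub>C\<^esub> f', h \<cdot>\<^bsub>D\<^esub> h'))\<rparr>"

locale cat_functor = dom: category C + cod: category D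
  for C :: "('o, 'a, 'y) cat_scheme" and D :: "('p, 'b, 'z) cat_scheme" +
  fixes Fo :: "'o \<Rightarrow> 'p" and Fa :: "'a \<Rightarrow> 'b"
  assumes F_ob: "x \<in> Ob C \<Longrightarrow> Fo x \<in> Ob D"
    and F_hom: "\<lbrakk>x \<in> Ob C; y \<in> Ob C; f \<in> Hom C x y\<rbrakk> \<Longrightarrow> Fa f \<in> Hom D (Fo x) (Fo y)"
    and F_Id: "x \<in> Ob C \<Longrightarrow> Fa (Id C x) = Id D (Fo x)"
    and F_Comp: "\<lbrakk>x \<in> Ob C; y \<in> Ob C; z \<in> Ob C; f \<in> Hom C x y; h \<in> Hom C y z\<rbrakk>
      \<Longrightarrow> Fa (h \<cdot>\<^bsub>C\<^esub> f) = Fa h \<cdot>\<^bsub>D\<^esub> Fa f"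

locale natural_isomorphism =
  F: cat_functor C D Fo Fa + G: cat_functor C D Go Ga
  for C :: "('o, 'a, 'y) cat_scheme" and D :: "('p, 'b, 'z) cat_scheme"
    and Fo Fa Go Ga +
  fixes \<alpha> :: "'o \<Rightarrow> 'b"
  assumes component_iso: "x \<in> Ob C \<Longrightarrow> \<alpha> x \<in> Iso D (Fo x) (Go x)"
    and naturality: "\<lbrakk>x \<in> Ob C; y \<in> Ob C; f \<in> Hom C x y\<rbrakk>
      \<Longrightarrow> \<alpha> y \<cdot>\<^bsub>D\<^esub> Fa f = Ga f \<cdot>\<^bsub>D\<^esub> \<alpha> x"

text \<open>
  The underlying category has all 1-cells as objects and all 2-cells as arrows, with vertical
  composition; it is the disjoint union of the hom-categories. The horizontal composite
  \<open>M \<odot> N\<close> is in diagrammatic order: first \<open>M\<close>, then \<open>N\<close>. On 2-cells it is written \<open>\<star>\<close>.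
\<close>

record ('o, 'm, 'c) bicat = "('m, 'c) cat" +
  Cells0 :: "'o set"
  Src :: "'m \<Rightarrow> 'o"
  Trg :: "'m \<Rightarrow> 'o"
  Unit :: "'o \<Rightarrow> 'm"
  HComp1 :: "'m \<Rightarrow> 'm \<Rightarrow> 'm" (infixl "\<odot>\<index>" 70)
  HComp2 :: "'c \<Rightarrow> 'c \<Rightarrow> 'c" (infixl "\<star>\<index>" 70)
  Assoc :: "'m \<Rightarrow> 'm \<Rightarrow> 'm \<Rightarrow> 'c"
  LUnit :: "'m \<Rightarrow> 'c"
  RUnit :: "'m \<Rightarrow> 'c"

definition hom_cat :: "('o, 'm, 'c, 'z) bicat_scheme \<Rightarrow> 'o \<Rightarrow> 'o \<Rightarrow> ('m, 'c) cat" where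
  "hom_cat B X Y = \<lparr>Ob = {M \<in> Ob B. Src B M = X \<and> Trg B M = Y},
     Hom = Hom B, Id = Id B, Comp = Comp B\<rparr>"

locale bicategory = category B
  for B :: "('o, 'm, 'c, 'z) bicat_scheme" (structure) +
  assumes Src_cell: "M \<in> Ob B \<Longrightarrow> Src B M \<in> Cells0 B"
    and Trg_cell: "M \<in> Ob B \<Longrightarrow> Trg B M \<in> Cells0 B"
    and parallel: "\<lbrakk>M \<in> Ob B; N \<in> Ob B; f \<in> Hom B M N\<rbrakk> \<Longrightarrow> Src B M = Src B N \<and> Trg B M = Trg B N"
    and Unit_cell: "X \<in> Cells0 B \<Longrightarrow> Unit B X \<in> Ob (hom_cat B X X)"
    and HComp_functor: "\<lbrakk>X \<in> Cells0 B; Y \<in> Cells0 B; Z \<in> Cells0 B\<rbrakk> \<Longrightarrow>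
      cat_functor (prod_cat (hom_cat B X Y) (hom_cat B Y Z)) (hom_cat B X Z)
        (\<lambda>(M, N). M \<odot> N) (\<lambda>(f, h). f \<star> h)"
    and Assoc_natural: "\<lbrakk>W \<in> Cells0 B; X \<in> Cells0 B; Y \<in> Cells0 B; Z \<in> Cells0 B\<rbrakk> \<Longrightarrow>
      natural_isomorphism
        (prod_cat (hom_cat B W X) (prod_cat (hom_cat B X Y) (hom_cat B Y Z))) (hom_cat B W Z)
        (\<lambda>(M, N, P). (M \<odot> N) \<odot> P) (\<lambda>(f, h, k). (f \<star> h) \<star> k)
        (\<lambda>(M, N, P). M \<odot> (N \<odot> P)) (\<lambda>(f, h, k). f \<star> (h \<star> k))
        (\<lambda>(M, N, P). Assoc B M N P)"
    and LUnit_natural: "\<lbrakk>X \<in> Cells0 B; Y \<in> Cells0 B\<rbrakk> \<Longrightarrow>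
      natural_isomorphism (hom_cat B X Y) (hom_cat B X Y)
        (\<lambda>M. Unit B X \<odot> M) (\<lambda>f. Id B (Unit B X) \<star> f) (\<lambda>M. M) (\<lambda>f. f) (LUnit B)"
    and RUnit_natural: "\<lbrakk>X \<in> Cells0 B; Y \<in> Cells0 B\<rbrakk> \<Longrightarrow>
      natural_isomorphism (hom_cat B X Y) (hom_cat B X Y)
        (\<lambda>M. M \<odot> Unit B Y) (\<lambda>f. f \<star> Id B (Unit B Y)) (\<lambda>M. M) (\<lambda>f. f) (RUnit B)"
    and triangle: "\<lbrakk>M \<in> Ob B; N \<in> Ob B; Trg B M = Src B N\<rbrakk> \<Longrightarrow>
      (Id B M \<star> LUnit B N) \<cdot> Assoc B M (Unit B (Trg B M)) N = RUnit B M \<star> Id B N"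
    and pentagon: "\<lbrakk>M \<in> Ob B; N \<in> Ob B; P \<in> Ob B; Q \<in> Ob B;
        Trg B M = Src B N; Trg B N = Src B P; Trg B P = Src B Q\<rbrakk> \<Longrightarrow>
      Assoc B M N (P \<odot> Q) \<cdot> Assoc B (M \<odot> N) P Q =
      (Id B M \<star> Assoc B N P Q) \<cdot> Assoc B M (N \<odot> P) Q \<cdot> (Assoc B M N P \<star> Id B Q)"

definition InvAssoc :: "('o, 'm, 'c, 'z) bicat_scheme \<Rightarrow> 'm \<Rightarrow> 'm \<Rightarrow> 'm \<Rightarrow> 'c" where
  "InvAssoc B M N P =
     Inv B ((M \<odot>\<^bsub>B\<^esub> N) \<odot>\<^bsub>B\<^esub> P) (M \<odot>\<^bsub>B\<^esub> (N \<odot>\<^bsub>B\<^esub> P)) (Assoc B M N P)"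

definition InvLUnit :: "('o, 'm, 'c, 'z) bicat_scheme \<Rightarrow> 'm \<Rightarrow> 'c" where
  "InvLUnit B M = Inv B (Unit B (Src B M) \<odot>\<^bsub>B\<^esub> M) M (LUnit B M)"

text \<open>The objects of \<open>Pic\<^sub>B(X)\<close>; its arrows are the invertible 2-cells between them.\<close>

definition Pic_ob :: "('o, 'm, 'c, 'z) bicat_scheme \<Rightarrow> 'o \<Rightarrow> 'm set" where
  "Pic_ob B X = {M \<in> Ob (hom_cat B X X). \<exists>N \<in> Ob (hom_cat B X X).
     Iso B (M \<odot>\<^bsub>B\<^esub> N) (Unit B X) \<noteq> {} \<and> Iso B (N \<odot>\<^bsub>B\<^esub> M) (Unit B X) \<noteq> {}}"

record ('o, 'm, 'c, 't, 'u) shadow =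
  ShOb :: "'o \<Rightarrow> 'm \<Rightarrow> 't"
  ShAr :: "'o \<Rightarrow> 'c \<Rightarrow> 'u"
  cyc :: "'m \<Rightarrow> 'm \<Rightarrow> 'u"

locale shadowed_bicategory = bicategory B + target: category T
  for B :: "('o, 'm, 'c, 'z) bicat_scheme" (structure)
    and T :: "('t, 'u, 'y) cat_scheme"
    and Sh :: "('o, 'm, 'c, 't, 'u) shadow" +
  assumes Sh_functor: "R \<in> Cells0 B \<Longrightarrow> cat_functor (hom_cat B R R) T (ShOb Sh R) (ShAr Sh R)"
    and cyc_natural: "\<lbrakk>R \<in> Cells0 B; S \<in> Cells0 B\<rbrakk> \<Longrightarrow>
      natural_isomorphism (prod_cat (hom_cat B R S) (hom_cat B S R)) T
        (\<lambda>(M, N). ShOb Sh R (M \<odot> N)) (\<lambda>(f, h). ShAr Sh R (f \<star> h))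
        (\<lambda>(M, N). ShOb Sh S (N \<odot> M)) (\<lambda>(f, h). ShAr Sh S (h \<star> f))
        (\<lambda>(M, N). cyc Sh M N)"
    and cyc_hexagon: "\<lbrakk>R \<in> Cells0 B; S \<in> Cells0 B; Q \<in> Cells0 B; M \<in> Ob (hom_cat B R S);
        N \<in> Ob (hom_cat B S Q); P \<in> Ob (hom_cat B Q R)\<rbrakk> \<Longrightarrow>
      cyc Sh (M \<odot> N) P =
      ShAr Sh Q (Assoc B P M N) \<cdot>\<^bsub>T\<^esub> cyc Sh N (P \<odot> M) \<cdot>\<^bsub>T\<^esub>
        ShAr Sh S (Assoc B N P M) \<cdot>\<^bsub>T\<^esub> cyc Sh M (N \<odot> P) \<cdot>\<^bsub>T\<^esub> ShAr Sh R (Assoc B M N P)"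
    and cyc_right_unit: "\<lbrakk>R \<in> Cells0 B; M \<in> Ob (hom_cat B R R)\<rbrakk> \<Longrightarrow>
      ShAr Sh R (LUnit B M) \<cdot>\<^bsub>T\<^esub> cyc Sh M (Unit B R) = ShAr Sh R (RUnit B M)"
    and cyc_left_unit: "\<lbrakk>R \<in> Cells0 B; M \<in> Ob (hom_cat B R R)\<rbrakk> \<Longrightarrow>
      ShAr Sh R (RUnit B M) \<cdot>\<^bsub>T\<^esub> cyc Sh (Unit B R) M = ShAr Sh R (LUnit B M)"

record ('o, 'g, 'm, 'c) twisting =
  Tw :: "'o \<Rightarrow> 'g \<Rightarrow> 'm"
  TwMult :: "'o \<Rightarrow> 'g \<Rightarrow> 'g \<Rightarrow> 'c"
  TwUnit :: "'o \<Rightarrow> 'c"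

text \<open>
  For each 0-cell \<open>X\<close>, \<open>Tw \<Theta> X\<close> is a strong monoidal functor from \<open>G\<close>, regarded as a discrete
  monoidal category, to \<open>Pic\<^sub>B(X)\<close>. Since \<open>G\<close> has only identity arrows, functoriality and the
  naturality of the structure 2-cells are automatic; what remains are the invertibility of the
  structure 2-cells and the associativity and unit coherence laws.
\<close>

locale twisting_data = bicategory B + group G
  for B :: "('o, 'm, 'c, 'z) bicat_scheme" and G :: "('g, 'y) monoid_scheme" (structure) +
  fixes \<Theta> :: "('o, 'g, 'm, 'c) twisting"
  assumes Tw_Pic: "\<lbrakk>X \<in> Cells0 B; g \<in> carrier G\<rbrakk> \<Longrightarrow> Tw \<Theta> X g \<in> Pic_ob B X"
    and TwMult_iso: "\<lbrakk>X \<in> Cells0 B; g \<in> carrier G; h \<in> carrier G\<rbrakk> \<Longrightarrow>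
      TwMult \<Theta> X g h \<in> Iso B (Tw \<Theta> X g \<odot>\<^bsub>B\<^esub> Tw \<Theta> X h) (Tw \<Theta> X (g \<otimes> h))"
    and TwUnit_iso: "X \<in> Cells0 B \<Longrightarrow> TwUnit \<Theta> X \<in> Iso B (Unit B X) (Tw \<Theta> X \<one>)"
    and TwMult_assoc: "\<lbrakk>X \<in> Cells0 B; g \<in> carrier G; h \<in> carrier G; k \<in> carrier G\<rbrakk> \<Longrightarrow>
      TwMult \<Theta> X (g \<otimes> h) k \<cdot>\<^bsub>B\<^esub> (TwMult \<Theta> X g h \<star>\<^bsub>B\<^esub> Id B (Tw \<Theta> X k)) =
      TwMult \<Theta> X g (h \<otimes> k) \<cdot>\<^bsub>B\<^esub> (Id B (Tw \<Theta> X g) \<star>\<^bsub>B\<^esub> TwMult \<Theta> X h k) \<cdot>\<^bsub>B\<^esub>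
        Assoc B (Tw \<Theta> X g) (Tw \<Theta> X h) (Tw \<Theta> X k)"
    and TwUnit_left: "\<lbrakk>X \<in> Cells0 B; g \<in> carrier G\<rbrakk> \<Longrightarrow>
      TwMult \<Theta> X \<one> g \<cdot>\<^bsub>B\<^esub> (TwUnit \<Theta> X \<star>\<^bsub>B\<^esub> Id B (Tw \<Theta> X g)) = LUnit B (Tw \<Theta> X g)"
    and TwUnit_right: "\<lbrakk>X \<in> Cells0 B; g \<in> carrier G\<rbrakk> \<Longrightarrow>
      TwMult \<Theta> X g \<one> \<cdot>\<^bsub>B\<^esub> (Id B (Tw \<Theta> X g) \<star>\<^bsub>B\<^esub> TwUnit \<Theta> X) = RUnit B (Tw \<Theta> X g)"

text \<open>
  A family of 2-cells indexed by \<open>G\<close> is an extensional function on \<open>carrier G\<close>. The associators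
  and unitors that are usually suppressed in the formulas for twists are written out.
\<close>

definition twisted_cell1 ::
  "('o, 'm, 'c, 'z) bicat_scheme \<Rightarrow> ('g, 'y) monoid_scheme \<Rightarrow> ('o, 'g, 'm, 'c) twisting \<Rightarrow>
   'm \<Rightarrow> ('g \<Rightarrow> 'c) \<Rightarrow> bool" where
  "twisted_cell1 B G \<Theta> M \<tau> \<longleftrightarrow>
    (let X = Src B M; Y = Trg B M in
     M \<in> Ob B \<and>
     \<tau> \<in> (\<Pi>\<^sub>E g\<in>carrier G. Iso B (Tw \<Theta> X g \<odot>\<^bsub>B\<^esub> M) (M \<odot>\<^bsub>B\<^esub> Tw \<Theta> Y g)) \<and>
     RUnit B M \<cdot>\<^bsub>B\<^esub> (Id B M \<star>\<^bsub>B\<^esub> Inv B (Unit B Y) (Tw \<Theta> Y \<one>\<^bsub>G\<^esub>) (TwUnit \<Theta> Y)) \<cdot>\<^bsub>B\<^esub>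
       \<tau> \<one>\<^bsub>G\<^esub> \<cdot>\<^bsub>B\<^esub> (TwUnit \<Theta> X \<star>\<^bsub>B\<^esub> Id B M) \<cdot>\<^bsub>B\<^esub> InvLUnit B M = Id B M \<and>
     (\<forall>g\<in>carrier G. \<forall>h\<in>carrier G.
       \<tau> (g \<otimes>\<^bsub>G\<^esub> h) =
         (Id B M \<star>\<^bsub>B\<^esub> TwMult \<Theta> Y g h) \<cdot>\<^bsub>B\<^esub>
         Assoc B M (Tw \<Theta> Y g) (Tw \<Theta> Y h) \<cdot>\<^bsub>B\<^esub>
         (\<tau> g \<star>\<^bsub>B\<^esub> Id B (Tw \<Theta> Y h)) \<cdot>\<^bsub>B\<^esub>
         InvAssoc B (Tw \<Theta> X g) M (Tw \<Theta> Y h) \<cdot>\<^bsub>B\<^esub>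
         (Id B (Tw \<Theta> X g) \<star>\<^bsub>B\<^esub> \<tau> h) \<cdot>\<^bsub>B\<^esub>
         Assoc B (Tw \<Theta> X g) (Tw \<Theta> X h) M \<cdot>\<^bsub>B\<^esub>
         (Inv B (Tw \<Theta> X g \<odot>\<^bsub>B\<^esub> Tw \<Theta> X h) (Tw \<Theta> X (g \<otimes>\<^bsub>G\<^esub> h)) (TwMult \<Theta> X g h) \<star>\<^bsub>B\<^esub> Id B M)))"

definition twisted_cell2 ::
  "('o, 'm, 'c, 'z) bicat_scheme \<Rightarrow> ('g, 'y) monoid_scheme \<Rightarrow> ('o, 'g, 'm, 'c) twisting \<Rightarrow>
   'm \<times> ('g \<Rightarrow> 'c) \<Rightarrow> 'm \<times> ('g \<Rightarrow> 'c) \<Rightarrow> 'c set" where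
  "twisted_cell2 B G \<Theta> = (\<lambda>(M, \<tau>) (N, \<sigma>). {f \<in> Hom B M N. \<forall>g\<in>carrier G.
     \<sigma> g \<cdot>\<^bsub>B\<^esub> (Id B (Tw \<Theta> (Src B M) g) \<star>\<^bsub>B\<^esub> f) =
     (f \<star>\<^bsub>B\<^esub> Id B (Tw \<Theta> (Trg B M) g)) \<cdot>\<^bsub>B\<^esub> \<tau> g})"

definition twisted_comp ::
  "('o, 'm, 'c, 'z) bicat_scheme \<Rightarrow> ('g, 'y) monoid_scheme \<Rightarrow> ('o, 'g, 'm, 'c) twisting \<Rightarrow>
   'm \<times> ('g \<Rightarrow> 'c) \<Rightarrow> 'm \<times> ('g \<Rightarrow> 'c) \<Rightarrow> 'm \<times> ('g \<Rightarrow> 'c)" where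
  "twisted_comp B G \<Theta> = (\<lambda>(M, \<tau>) (N, \<sigma>). (M \<odot>\<^bsub>B\<^esub> N, \<lambda>g\<in>carrier G.
     InvAssoc B M N (Tw \<Theta> (Trg B N) g) \<cdot>\<^bsub>B\<^esub>
     (Id B M \<star>\<^bsub>B\<^esub> \<sigma> g) \<cdot>\<^bsub>B\<^esub>
     Assoc B M (Tw \<Theta> (Trg B M) g) N \<cdot>\<^bsub>B\<^esub>
     (\<tau> g \<star>\<^bsub>B\<^esub> Id B N) \<cdot>\<^bsub>B\<^esub>
     InvAssoc B (Tw \<Theta> (Src B M) g) M N))"

definition twist_bicat ::
  "('o, 'm, 'c, 'z) bicat_scheme \<Rightarrow> ('g, 'y) monoid_scheme \<Rightarrow> ('o, 'g, 'm, 'c) twisting \<Rightarrow>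
   ('o, 'm \<times> ('g \<Rightarrow> 'c), 'c) bicat" where
  "twist_bicat B G \<Theta> = \<lparr>
     Ob = {(M, \<tau>). twisted_cell1 B G \<Theta> M \<tau>},
     Hom = twisted_cell2 B G \<Theta>,
     Id = (\<lambda>(M, \<tau>). Id B M),
     Comp = Comp B,
     Cells0 = Cells0 B,
     Src = (\<lambda>(M, \<tau>). Src B M),
     Trg = (\<lambda>(M, \<tau>). Trg B M),
     Unit = (\<lambda>X. (Unit B X, \<lambda>g\<in>carrier G. InvLUnit B (Tw \<Theta> X g) \<cdot>\<^bsub>B\<^esub> RUnit B (Tw \<Theta> X g))),
     HComp1 = twisted_comp B G \<Theta>,
     HComp2 = HComp2 B,
     Assoc = (\<lambda>(M, _) (N, _) (P, _). Assoc B M N P),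
     LUnit = (\<lambda>(M, _). LUnit B M),
     RUnit = (\<lambda>(M, _). RUnit B M)\<rparr>"

text \<open>The left twist of a 1-cell \<open>M\<close>, respectively of a 2-cell \<open>f\<close>, with source 0-cell \<open>X\<close>.\<close>

definition left_twist1 ::
  "('o, 'm, 'c, 'z) bicat_scheme \<Rightarrow> ('g, 'y) monoid_scheme \<Rightarrow> ('o, 'g, 'm, 'c) twisting \<Rightarrow>
   'g \<Rightarrow> 'o \<Rightarrow> 'm \<Rightarrow> 'm" where
  "left_twist1 B G \<Theta> g X M = Tw \<Theta> X (inv\<^bsub>G\<^esub> g) \<odot>\<^bsub>B\<^esub> M"

definition left_twist2 ::
  "('o, 'm, 'c, 'z) bicat_scheme \<Rightarrow> ('g, 'y) monoid_scheme \<Rightarrow> ('o, 'g, 'm, 'c) twisting \<Rightarrow>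
   'g \<Rightarrow> 'o \<Rightarrow> 'c \<Rightarrow> 'c" where
  "left_twist2 B G \<Theta> g X f = Id B (Tw \<Theta> X (inv\<^bsub>G\<^esub> g)) \<star>\<^bsub>B\<^esub> f"

definition twisted_ShOb ::
  "('o, 'm, 'c, 'z) bicat_scheme \<Rightarrow> ('g, 'y) monoid_scheme \<Rightarrow> ('o, 'g, 'm, 'c) twisting \<Rightarrow>
   ('o, 'm, 'c, 't, 'u) shadow \<Rightarrow> 'g \<Rightarrow> 'o \<Rightarrow> 'm \<times> ('g \<Rightarrow> 'c) \<Rightarrow> 't" where
  "twisted_ShOb B G \<Theta> Sh g R = (\<lambda>(M, \<tau>). ShOb Sh R (left_twist1 B G \<Theta> g R M))"

definition twisted_ShAr ::
  "('o, 'm, 'c, 'z) bicat_scheme \<Rightarrow> ('g, 'y) monoid_scheme \<Rightarrow> ('o, 'g, 'm, 'c) twisting \<Rightarrow>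
   ('o, 'm, 'c, 't, 'u) shadow \<Rightarrow> 'g \<Rightarrow> 'o \<Rightarrow> 'c \<Rightarrow> 'u" where
  "twisted_ShAr B G \<Theta> Sh g R f = ShAr Sh R (left_twist2 B G \<Theta> g R f)"

end

theory Submission
  imports Defs
begin

text \<open>
  Write \<open>h = g\<inverse>\<close>, let \<open>H\<^sub>R = \<Theta>\<^sub>R(h)\<close>, and take twisted 1-cells \<open>(N, \<sigma>) : S \<rightarrow> R\<close> and
  \<open>(M, \<tau>) : R \<rightarrow> S\<close>. The 2-cell \<open>\<sigma>\<^sub>h : H\<^sub>S \<odot> N \<Rightarrow> N \<odot> H\<^sub>R\<close> carries the twist past \<open>N\<close>, after which
  the shadow rotates \<open>N\<close> to the back:
    \<open>c(N, M) : \<langle>H\<^sub>S (N M)\<rangle> \<rightarrow> \<langle>N (H\<^sub>R M)\<rangle> \<rightarrow> \<langle>(H\<^sub>R M) N\<rangle> \<rightarrow> \<langle>H\<^sub>R (M N)\<rangle>\<close>.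

  There are two candidates for the twisted cyclic isomorphism from \<open>\<langle>H\<^sub>R (M N)\<rangle>\<close> to \<open>\<langle>H\<^sub>S (N M)\<rangle>\<close>,
  namely \<open>c(M, N)\<close> and \<open>c(N, M)\<inverse>\<close>, and they differ: \<open>c(N, M) c(M, N)\<close> carries the twist once around
  the whole loop, which is a nontrivial automorphism in general. (If \<open>\<Theta>\<close> is trivial then a
  twist is an action of \<open>G\<close>, and this automorphism is the one that \<open>h\<close> induces on \<open>\<langle>M N\<rangle>\<close>.) In the hexagon, the
  left side takes \<open>M \<odot> N\<close> and then \<open>P \<odot> M\<close> to the back. With \<open>c(M, N)\<close> the twist would
  there pass \<open>M\<close>, \<open>N\<close>, \<open>P\<close> and \<open>M\<close> again, but only \<open>M\<close> on the right side, so the two sides would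
  differ by one turn around the loop. The inverses \<open>c(N, M)\<inverse>\<close> instead bring \<open>P\<close> and then \<open>N\<close>
  to the front past the twist on the left side, and \<open>N \<odot> P\<close> on the right side. These agree,
  because the twist of a composite passes its factors one after the other. The triangle is treated in
  the same way: \<open>c(U, M)\<inverse>\<close> only moves the unit past the twist, while \<open>c(M, U)\<close> would again make
  a full turn. Hence the twisted cyclic isomorphism is \<open>c(N, M)\<inverse>\<close>, called \<open>twisted_cyc M N\<close> below.

  What has to be checked is therefore \<open>c(N P, M) = c(P, M N) c(N, P M)\<close> up to associators
  (\<open>fwd_cyc_hexagon\<close>). It follows from the hexagon of the given shadow for \<open>N\<close>, \<open>P\<close>, \<open>H \<odot> M\<close>
  and the naturality of its cyclic isomorphism, once the 2-cell \<open>H (N M) \<Rightarrow> N (H M)\<close> is known to be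
  compatible with associators on the right (\<open>move_past_whisker\<close>) and with the composition of twists
  (\<open>move_past_comp_twist\<close>). Two further facts enter. The triangle needs Kelly's two coherence laws
  for the unitors of a composite (\<open>tlunit_hcomp\<close>, \<open>trunit_hcomp\<close>). And the inverse of the associator
  in the bicategory of twists is the one in the underlying bicategory (\<open>InvAssoc_W\<close>), since
  associators are twisted 2-cells (\<open>comp_twist_assoc\<close>).
\<close>

section \<open>Typed arrows\<close>

text \<open>
  As hom-sets may overlap, an arrow alone does not determine its domain and codomain. A triple
  of domain, arrow and codomain does, so whether two triples can be composed is an equation between
  closed terms, which the simplifier decides.
\<close>

definition tdom :: "'o \<times> 'a \<times> 'o \<Rightarrow> 'o" where "tdom t = fst t"
definition tmor :: "'o \<times> 'a \<times> 'o \<Rightarrow> 'a" where "tmor t = fst (snd t)"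
definition tcod :: "'o \<times> 'a \<times> 'o \<Rightarrow> 'o" where "tcod t = snd (snd t)"

lemma tdom_triple [simp]: "tdom (x, f, y) = x"
  and tmor_triple [simp]: "tmor (x, f, y) = f"
  and tcod_triple [simp]: "tcod (x, f, y) = y"
  by (simp_all add: tdom_def tmor_def tcod_def)

lemma typed_eqI: "\<lbrakk>tdom t = tdom s; tmor t = tmor s; tcod t = tcod s\<rbrakk> \<Longrightarrow> t = s"
  by (cases t; cases s) simp

definition arrow :: "('o, 'a, 'z) cat_scheme \<Rightarrow> 'o \<times> 'a \<times> 'o \<Rightarrow> bool" where
  "arrow C t \<longleftrightarrow> tdom t \<in> Ob C \<and> tcod t \<in> Ob C \<and> tmor t \<in> Hom C (tdom t) (tcod t)"

definition tid :: "('o, 'a, 'z) cat_scheme \<Rightarrow> 'o \<Rightarrow> 'o \<times> 'a \<times> 'o" where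
  "tid C x = (x, Id C x, x)"

definition tcomp :: "('o, 'a, 'z) cat_scheme \<Rightarrow> 'o \<times> 'a \<times> 'o \<Rightarrow> 'o \<times> 'a \<times> 'o \<Rightarrow> 'o \<times> 'a \<times> 'o"
  (infixr "\<bullet>\<index>" 55) where
  "tcomp C t s = (tdom s, tmor t \<cdot>\<^bsub>C\<^esub> tmor s, tcod t)"

definition tiso :: "('o, 'a, 'z) cat_scheme \<Rightarrow> 'o \<times> 'a \<times> 'o \<Rightarrow> bool" where
  "tiso C t \<longleftrightarrow> tdom t \<in> Ob C \<and> tcod t \<in> Ob C \<and> tmor t \<in> Iso C (tdom t) (tcod t)"

definition tinv :: "('o, 'a, 'z) cat_scheme \<Rightarrow> 'o \<times> 'a \<times> 'o \<Rightarrow> 'o \<times> 'a \<times> 'o" where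
  "tinv C t = (tcod t, Inv C (tdom t) (tcod t) (tmor t), tdom t)"

lemma tdom_simps [simp]: "tdom (tid C x) = x" "tdom (t \<bullet>\<^bsub>C\<^esub> s) = tdom s" "tdom (tinv C t) = tcod t"
  and tcod_simps [simp]: "tcod (tid C x) = x" "tcod (t \<bullet>\<^bsub>C\<^esub> s) = tcod t" "tcod (tinv C t) = tdom t"
  and tmor_simps: "tmor (tid C x) = Id C x" "tmor (t \<bullet>\<^bsub>C\<^esub> s) = tmor t \<cdot>\<^bsub>C\<^esub> tmor s"
    "tmor (tinv C t) = Inv C (tdom t) (tcod t) (tmor t)"
  by (simp_all add: tid_def tcomp_def tinv_def)

context category
begin

lemma arrow_tid [simp]: "x \<in> Ob C \<Longrightarrow> arrow C (tid C x)"
  by (simp add: arrow_def tid_def Id_hom)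

lemma arrow_tcomp [simp]: "\<lbrakk>arrow C t; arrow C s; tcod s = tdom t\<rbrakk> \<Longrightarrow> arrow C (t \<bullet> s)"
  by (auto simp: arrow_def tcomp_def intro: Comp_hom)

lemma tid_left [simp]: "\<lbrakk>arrow C t; tcod t = x\<rbrakk> \<Longrightarrow> tid C x \<bullet> t = t"
  using Id_left[of "tdom t" x "tmor t"] by (auto simp: arrow_def tcomp_def tid_def intro: typed_eqI)

lemma tid_right [simp]: "\<lbrakk>arrow C t; tdom t = x\<rbrakk> \<Longrightarrow> t \<bullet> tid C x = t"
  using Id_right[of x "tcod t" "tmor t"] by (auto simp: arrow_def tcomp_def tid_def intro: typed_eqI)

lemma tcomp_assoc [simp]:
  "\<lbrakk>arrow C u; arrow C t; arrow C s; tcod t = tdom u; tcod s = tdom t\<rbrakk>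
    \<Longrightarrow> (u \<bullet> t) \<bullet> s = u \<bullet> (t \<bullet> s)"
  using Comp_assoc[of "tdom s" "tdom t" "tdom u" "tcod u" "tmor s" "tmor t" "tmor u"]
  by (simp add: arrow_def tcomp_def)

lemma arrow_Ob: "arrow C t \<Longrightarrow> tdom t \<in> Ob C" "arrow C t \<Longrightarrow> tcod t \<in> Ob C"
  by (simp_all add: arrow_def)

lemma inverse_arrows_unique:
  assumes "x \<in> Ob C" "y \<in> Ob C" "inverse_arrows C x y f h" "inverse_arrows C x y f k"
  shows "h = k"
proof -
  have "h = (k \<cdot> f) \<cdot> h"
    using assms Id_left[of y x h] by (simp add: inverse_arrows_def)
  also have "\<dots> = k \<cdot> (f \<cdot> h)"
    using assms by (intro Comp_assoc[of y x y x]) (auto simp: inverse_arrows_def)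
  also have "\<dots> = k"
    using assms Id_right[of y x k] by (simp add: inverse_arrows_def)
  finally show ?thesis .
qed

lemma Inv_eqI:
  "\<lbrakk>x \<in> Ob C; y \<in> Ob C; inverse_arrows C x y f h\<rbrakk> \<Longrightarrow> Inv C x y f = h"
  unfolding Inv_def by (rule the_equality) (auto intro: inverse_arrows_unique)

lemma inverse_arrows_Inv:
  "\<lbrakk>x \<in> Ob C; y \<in> Ob C; f \<in> Iso C x y\<rbrakk> \<Longrightarrow> inverse_arrows C x y f (Inv C x y f)"
  unfolding Iso_def using Inv_eqI[of x y f] by fastforce

lemma tiso_arrow: "tiso C t \<Longrightarrow> arrow C t"
  by (auto simp: tiso_def arrow_def Iso_def inverse_arrows_def)

lemma tiso_inverse:
  assumes "tiso C t"
  shows arrow_tinv [simp]: "arrow C (tinv C t)"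
    and tinv_left [simp]: "tinv C t \<bullet> t = tid C (tdom t)"
    and tinv_right [simp]: "t \<bullet> tinv C t = tid C (tcod t)"
  using assms inverse_arrows_Inv[of "tdom t" "tcod t" "tmor t"]
  by (auto simp: tiso_def arrow_def inverse_arrows_def tcomp_def tinv_def tid_def)

lemma tisoI:
  assumes "arrow C t" "arrow C s" "tcod s = tdom t" "tdom s = tcod t"
    "s \<bullet> t = tid C (tdom t)" "t \<bullet> s = tid C (tcod t)"
  shows "tiso C t" "tinv C t = s"
proof -
  have i: "inverse_arrows C (tdom t) (tcod t) (tmor t) (tmor s)"
    using assms by (auto simp: inverse_arrows_def arrow_def tcomp_def tid_def)
  then show "tiso C t"
    using assms arrow_Ob[OF assms(1)] by (auto simp: tiso_def Iso_def)
  show "tinv C t = s"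
    using i assms arrow_Ob[OF assms(1)] by (auto simp: tinv_def Inv_eqI intro!: typed_eqI)
qed

declare arrow_Ob [simp]

lemma arrow_Hom: "arrow C t \<Longrightarrow> tmor t \<in> Hom C (tdom t) (tcod t)"
  by (simp add: arrow_def del: arrow_Ob)

text \<open>
  Composites are kept associated to the right. An equation between short composites is applied inside
  a longer one through its extension by an arbitrary arrow on the right.
\<close>

lemma tcomp_tail:
  assumes "t \<bullet> s = u" "arrow C t" "arrow C s" "arrow C v" "tcod s = tdom t" "tcod v = tdom s"
  shows "t \<bullet> s \<bullet> v = u \<bullet> v"
  using tcomp_assoc[of t s v] assms by simp

lemma tcomp_tail3:
  assumes "r \<bullet> t \<bullet> s = u" "arrow C r" "arrow C t" "arrow C s" "arrow C v"
    "tcod t = tdom r" "tcod s = tdom t" "tcod v = tdom s"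
  shows "r \<bullet> t \<bullet> s \<bullet> v = u \<bullet> v"
  using tcomp_assoc[of r "t \<bullet> s" v] tcomp_assoc[of t s v] assms by simp

lemma tinv_left_tail [simp]:
  "\<lbrakk>tiso C t; arrow C v; tcod v = tdom t\<rbrakk> \<Longrightarrow> tinv C t \<bullet> t \<bullet> v = v"
  by (simp add: tcomp_tail[OF tinv_left] tiso_arrow)

lemma tinv_right_tail [simp]:
  "\<lbrakk>tiso C t; arrow C v; tcod v = tcod t\<rbrakk> \<Longrightarrow> t \<bullet> tinv C t \<bullet> v = v"
  by (simp add: tcomp_tail[OF tinv_right] tiso_arrow)

lemma tiso_tinv [simp]: "tiso C t \<Longrightarrow> tiso C (tinv C t)"
  by (rule tisoI[of _ t]) (simp_all add: tiso_arrow)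

lemma tiso_tcomp [simp]:
  "\<lbrakk>tiso C t; tiso C s; tcod s = tdom t\<rbrakk> \<Longrightarrow> tiso C (t \<bullet> s)"
  by (rule tisoI[of _ "tinv C s \<bullet> tinv C t"]) (simp_all add: tiso_arrow)

lemma tiso_tid [simp]: "x \<in> Ob C \<Longrightarrow> tiso C (tid C x)"
  by (rule tisoI[of _ "tid C x"]) simp_all

lemma tcomp_left_cancel:
  assumes "tiso C t" "arrow C s" "arrow C u" "tcod s = tdom t" "tcod u = tdom t" "t \<bullet> s = t \<bullet> u"
  shows "s = u"
proof -
  have "s = tinv C t \<bullet> t \<bullet> s"
    using assms(1-4) by simp
  also have "\<dots> = tinv C t \<bullet> t \<bullet> u"
    by (simp only: assms(6))
  also have "\<dots> = u"
    using assms(1-5) by simp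
  finally show ?thesis .
qed

lemma tcomp_right_cancel:
  assumes "tiso C t" "arrow C s" "arrow C u" "tdom s = tcod t" "tdom u = tcod t" "s \<bullet> t = u \<bullet> t"
  shows "s = u"
proof -
  have "s = (s \<bullet> t) \<bullet> tinv C t"
    using assms(1-5) by (simp add: tiso_arrow)
  also have "\<dots> = (u \<bullet> t) \<bullet> tinv C t"
    by (simp only: assms(6))
  also have "\<dots> = u"
    using assms(1-5) by (simp add: tiso_arrow)
  finally show ?thesis .
qed

lemma tinv_unique:
  "\<lbrakk>tiso C t; arrow C s; tcod s = tdom t; tdom s = tcod t; s \<bullet> t = tid C (tdom t)\<rbrakk> \<Longrightarrow> s = tinv C t"
  by (rule tcomp_right_cancel[of t]) simp_all

lemma tinv_simps [simp]:
  "tiso C t \<Longrightarrow> tinv C (tinv C t) = t"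
  "\<lbrakk>tiso C t; tiso C s; tcod s = tdom t\<rbrakk> \<Longrightarrow> tinv C (t \<bullet> s) = tinv C s \<bullet> tinv C t"
  "x \<in> Ob C \<Longrightarrow> tinv C (tid C x) = tid C x"
  by (rule sym, rule tinv_unique; simp add: tiso_arrow)+

lemma inverse_arrows_tinv:
  "tiso C t \<Longrightarrow> inverse_arrows C (tdom t) (tcod t) (tmor t) (tmor (tinv C t))"
  using inverse_arrows_Inv[of "tdom t" "tcod t" "tmor t"] by (simp add: tiso_def tmor_simps(3))

lemma tmor_tiso: "tiso C t \<Longrightarrow> tmor t \<in> Iso C (tdom t) (tcod t)"
  by (simp add: tiso_def)

text \<open>
  The inverses of the components of a natural isomorphism are again natural.
\<close>

lemma tinv_square:
  assumes "t \<bullet> u = v \<bullet> s" "tiso C t" "tiso C s" "arrow C u" "arrow C v"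
    "tcod u = tdom t" "tdom v = tcod s" "tdom u = tdom s" "tcod v = tcod t"
  shows "tinv C t \<bullet> v = u \<bullet> tinv C s"
proof -
  have "tinv C t \<bullet> v = tinv C t \<bullet> (v \<bullet> s) \<bullet> tinv C s"
    using assms(2-) by (simp add: tiso_arrow)
  also have "\<dots> = u \<bullet> tinv C s"
    using assms(2-) by (simp add: tiso_arrow flip: assms(1))
  finally show ?thesis .
qed

end

section \<open>Bicategories through typed 2-cells\<close>

definition thor :: "('o, 'm, 'c, 'z) bicat_scheme \<Rightarrow> 'm \<times> 'c \<times> 'm \<Rightarrow> 'm \<times> 'c \<times> 'm \<Rightarrow> 'm \<times> 'c \<times> 'm"
  (infixl "\<ast>\<index>" 70) where
  "thor B t s = (tdom t \<odot>\<^bsub>B\<^esub> tdom s, tmor t \<star>\<^bsub>B\<^esub> tmor s, tcod t \<odot>\<^bsub>B\<^esub> tcod s)"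

definition tassoc :: "('o, 'm, 'c, 'z) bicat_scheme \<Rightarrow> 'm \<Rightarrow> 'm \<Rightarrow> 'm \<Rightarrow> 'm \<times> 'c \<times> 'm" where
  "tassoc B M N P = ((M \<odot>\<^bsub>B\<^esub> N) \<odot>\<^bsub>B\<^esub> P, Assoc B M N P, M \<odot>\<^bsub>B\<^esub> (N \<odot>\<^bsub>B\<^esub> P))"

definition tlunit :: "('o, 'm, 'c, 'z) bicat_scheme \<Rightarrow> 'm \<Rightarrow> 'm \<times> 'c \<times> 'm" where
  "tlunit B M = (Unit B (Src B M) \<odot>\<^bsub>B\<^esub> M, LUnit B M, M)"

definition trunit :: "('o, 'm, 'c, 'z) bicat_scheme \<Rightarrow> 'm \<Rightarrow> 'm \<times> 'c \<times> 'm" where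
  "trunit B M = (M \<odot>\<^bsub>B\<^esub> Unit B (Trg B M), RUnit B M, M)"

lemma thor_simps [simp]:
  "tdom (t \<ast>\<^bsub>B\<^esub> s) = tdom t \<odot>\<^bsub>B\<^esub> tdom s" "tcod (t \<ast>\<^bsub>B\<^esub> s) = tcod t \<odot>\<^bsub>B\<^esub> tcod s"
  by (simp_all add: thor_def)

lemma tassoc_simps [simp]:
  "tdom (tassoc B M N P) = (M \<odot>\<^bsub>B\<^esub> N) \<odot>\<^bsub>B\<^esub> P"
  "tcod (tassoc B M N P) = M \<odot>\<^bsub>B\<^esub> (N \<odot>\<^bsub>B\<^esub> P)"
  by (simp_all add: tassoc_def)

lemma Assoc_eq: "Assoc B M N P = tmor (tassoc B M N P)"
  by (simp add: tassoc_def)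

lemma tunit_simps [simp]:
  "tdom (tlunit B M) = Unit B (Src B M) \<odot>\<^bsub>B\<^esub> M" "tcod (tlunit B M) = M"
  "tdom (trunit B M) = M \<odot>\<^bsub>B\<^esub> Unit B (Trg B M)" "tcod (trunit B M) = M"
  by (simp_all add: tlunit_def trunit_def)

context bicategory
begin

lemma Ob_hom_cat: "M \<in> Ob (hom_cat B X Y) \<longleftrightarrow> M \<in> Ob B \<and> Src B M = X \<and> Trg B M = Y"
  by (simp add: hom_cat_def)

declare Src_cell [simp] Trg_cell [simp]

lemma Unit_simps [simp]:
  "X \<in> Cells0 B \<Longrightarrow> Unit B X \<in> Ob B"
  "X \<in> Cells0 B \<Longrightarrow> Src B (Unit B X) = X"
  "X \<in> Cells0 B \<Longrightarrow> Trg B (Unit B X) = X"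
  using Unit_cell by (auto simp: Ob_hom_cat)

lemma HComp1_simps [simp]:
  assumes "M \<in> Ob B" "N \<in> Ob B" "Trg B M = Src B N"
  shows "M \<odot> N \<in> Ob B" "Src B (M \<odot> N) = Src B M" "Trg B (M \<odot> N) = Trg B N"
proof -
  interpret H: cat_functor "prod_cat (hom_cat B (Src B M) (Src B N)) (hom_cat B (Src B N) (Trg B N))"
    "hom_cat B (Src B M) (Trg B N)" "\<lambda>(M, N). M \<odot> N" "\<lambda>(f, h). f \<star> h"
    by (rule HComp_functor) (use assms in simp_all)
  have "M \<odot> N \<in> Ob (hom_cat B (Src B M) (Trg B N))"
    using H.F_ob[of "(M, N)"] assms by (simp add: prod_cat_def Ob_hom_cat)
  then show "M \<odot> N \<in> Ob B" "Src B (M \<odot> N) = Src B M" "Trg B (M \<odot> N) = Trg B N"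
    by (simp_all add: Ob_hom_cat)
qed

lemma arrow_parallel:
  "arrow B t \<Longrightarrow> Src B (tdom t) = Src B (tcod t)" "arrow B t \<Longrightarrow> Trg B (tdom t) = Trg B (tcod t)"
  using parallel[of "tdom t" "tcod t" "tmor t"] by (simp_all add: arrow_def del: arrow_Ob)

lemma arrow_thor [simp]:
  assumes "arrow B t" "arrow B s" "Trg B (tdom t) = Src B (tdom s)"
  shows "arrow B (t \<ast> s)"
proof -
  note p = arrow_parallel[OF assms(1)] arrow_parallel[OF assms(2)]
  interpret H: cat_functor
    "prod_cat (hom_cat B (Src B (tdom t)) (Trg B (tdom t))) (hom_cat B (Src B (tdom s)) (Trg B (tdom s)))"
    "hom_cat B (Src B (tdom t)) (Trg B (tdom s))" "\<lambda>(M, N). M \<odot> N" "\<lambda>(f, h). f \<star> h"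
    using HComp_functor[of "Src B (tdom t)" "Trg B (tdom t)" "Trg B (tdom s)"] assms by simp
  have "tmor t \<star> tmor s \<in> Hom B (tdom t \<odot> tdom s) (tcod t \<odot> tcod s)"
    using H.F_hom[of "(tdom t, tdom s)" "(tcod t, tcod s)" "(tmor t, tmor s)"] assms p
    by (simp add: prod_cat_def hom_cat_def arrow_def del: arrow_Ob)
  moreover have "Trg B (tcod t) = Src B (tcod s)"
    using assms p by simp
  ultimately show ?thesis
    using assms by (simp add: arrow_def thor_def del: arrow_Ob)
qed

lemma thor_tid [simp]:
  assumes "M \<in> Ob B" "N \<in> Ob B" "Trg B M = Src B N"
  shows "tid B M \<ast> tid B N = tid B (M \<odot> N)"
proof -
  interpret H: cat_functor "prod_cat (hom_cat B (Src B M) (Src B N)) (hom_cat B (Src B N) (Trg B N))"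
    "hom_cat B (Src B M) (Trg B N)" "\<lambda>(M, N). M \<odot> N" "\<lambda>(f, h). f \<star> h"
    by (rule HComp_functor) (use assms in simp_all)
  show ?thesis
    using H.F_Id[of "(M, N)"] assms by (simp add: prod_cat_def hom_cat_def thor_def tid_def)
qed

lemma interchange:
  assumes "arrow B t" "arrow B s" "arrow B t'" "arrow B s'"
    "tcod t = tdom t'" "tcod s = tdom s'" "Trg B (tdom t) = Src B (tdom s)"
  shows "(t' \<ast> s') \<bullet> (t \<ast> s) = (t' \<bullet> t) \<ast> (s' \<bullet> s)"
proof -
  note p = assms(1-4)[THEN arrow_parallel(1)] assms(1-4)[THEN arrow_parallel(2)]
  interpret H: cat_functor
    "prod_cat (hom_cat B (Src B (tdom t)) (Trg B (tdom t))) (hom_cat B (Src B (tdom s)) (Trg B (tdom s)))"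
    "hom_cat B (Src B (tdom t)) (Trg B (tdom s))" "\<lambda>(M, N). M \<odot> N" "\<lambda>(f, h). f \<star> h"
    using HComp_functor[of "Src B (tdom t)" "Trg B (tdom t)" "Trg B (tdom s)"] assms by simp
  have "(tmor t' \<cdot> tmor t) \<star> (tmor s' \<cdot> tmor s) = (tmor t' \<star> tmor s') \<cdot> (tmor t \<star> tmor s)"
    using H.F_Comp[of "(tdom t, tdom s)" "(tcod t, tcod s)" "(tcod t', tcod s')"
      "(tmor t, tmor s)" "(tmor t', tmor s')"] assms p
    by (simp add: prod_cat_def hom_cat_def arrow_def del: arrow_Ob)
  then show ?thesis
    by (simp add: thor_def tcomp_def)
qed


lemma whisker_left:
  "\<lbrakk>arrow B t; arrow B s; tcod s = tdom t; M \<in> Ob B; Trg B M = Src B (tdom s)\<rbrakk>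
    \<Longrightarrow> tid B M \<ast> (t \<bullet> s) = (tid B M \<ast> t) \<bullet> (tid B M \<ast> s)"
  by (subst interchange) simp_all

lemma whisker_right:
  "\<lbrakk>arrow B t; arrow B s; tcod s = tdom t; M \<in> Ob B; Trg B (tdom s) = Src B M\<rbrakk>
    \<Longrightarrow> (t \<bullet> s) \<ast> tid B M = (t \<ast> tid B M) \<bullet> (s \<ast> tid B M)"
  by (subst interchange) simp_all

lemma thor_tiso:
  assumes "tiso B t" "tiso B s" "Trg B (tdom t) = Src B (tdom s)"
  shows tiso_thor [simp]: "tiso B (t \<ast> s)"
    and tinv_thor [simp]: "tinv B (t \<ast> s) = tinv B t \<ast> tinv B s"
proof -
  note a = assms(1,2)[THEN tiso_arrow]
  have p: "Trg B (tcod t) = Src B (tcod s)"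
    using assms(3) a[THEN arrow_parallel(1)] a[THEN arrow_parallel(2)] by simp
  have "(tinv B t \<ast> tinv B s) \<bullet> (t \<ast> s) = tid B (tdom (t \<ast> s))"
    "(t \<ast> s) \<bullet> (tinv B t \<ast> tinv B s) = tid B (tcod (t \<ast> s))"
    using assms a p by (simp_all add: interchange)
  then show "tiso B (t \<ast> s)" "tinv B (t \<ast> s) = tinv B t \<ast> tinv B s"
    using tisoI[of "t \<ast> s" "tinv B t \<ast> tinv B s"] assms a p by simp_all
qed

lemma whiskered_inverse [simp]:
  assumes "tiso B t" "M \<in> Ob B"
  shows "Trg B M = Src B (tdom t) \<Longrightarrow>
      (tid B M \<ast> tinv B t) \<bullet> (tid B M \<ast> t) = tid B (M \<odot> tdom t)"
    and "Trg B M = Src B (tdom t) \<Longrightarrow>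
      (tid B M \<ast> t) \<bullet> (tid B M \<ast> tinv B t) = tid B (M \<odot> tcod t)"
    and "Trg B (tdom t) = Src B M \<Longrightarrow>
      (tinv B t \<ast> tid B M) \<bullet> (t \<ast> tid B M) = tid B (tdom t \<odot> M)"
    and "Trg B (tdom t) = Src B M \<Longrightarrow>
      (t \<ast> tid B M) \<bullet> (tinv B t \<ast> tid B M) = tid B (tcod t \<odot> M)"
  using tinv_left[of "tid B M \<ast> t"] tinv_right[of "tid B M \<ast> t"]
    tinv_left[of "t \<ast> tid B M"] tinv_right[of "t \<ast> tid B M"] assms
  by simp_all

lemma whiskered_inverse_tail [simp]:
  assumes "tiso B t" "M \<in> Ob B" "arrow B v"
  shows "\<lbrakk>Trg B M = Src B (tdom t); tcod v = M \<odot> tdom t\<rbrakk> \<Longrightarrow>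
      (tid B M \<ast> tinv B t) \<bullet> (tid B M \<ast> t) \<bullet> v = v"
    and "\<lbrakk>Trg B M = Src B (tdom t); tcod v = M \<odot> tcod t\<rbrakk> \<Longrightarrow>
      (tid B M \<ast> t) \<bullet> (tid B M \<ast> tinv B t) \<bullet> v = v"
    and "\<lbrakk>Trg B (tdom t) = Src B M; tcod v = tdom t \<odot> M\<rbrakk> \<Longrightarrow>
      (tinv B t \<ast> tid B M) \<bullet> (t \<ast> tid B M) \<bullet> v = v"
    and "\<lbrakk>Trg B (tdom t) = Src B M; tcod v = tcod t \<odot> M\<rbrakk> \<Longrightarrow>
      (t \<ast> tid B M) \<bullet> (tinv B t \<ast> tid B M) \<bullet> v = v"
  using tinv_left_tail[of "tid B M \<ast> t" v] tinv_right_tail[of "tid B M \<ast> t" v]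
    tinv_left_tail[of "t \<ast> tid B M" v] tinv_right_tail[of "t \<ast> tid B M" v] assms
  by simp_all

lemma tiso_tassoc [simp]:
  assumes "M \<in> Ob B" "N \<in> Ob B" "P \<in> Ob B" "Trg B M = Src B N" "Trg B N = Src B P"
  shows "tiso B (tassoc B M N P)"
  using natural_isomorphism.component_iso
    [OF Assoc_natural[of "Src B M" "Trg B M" "Trg B N" "Trg B P"], of "(M, N, P)"] assms
  by (simp add: tiso_def prod_cat_def hom_cat_def tassoc_def Iso_def inverse_arrows_def)

lemma arrow_tassoc [simp]:
  "\<lbrakk>M \<in> Ob B; N \<in> Ob B; P \<in> Ob B; Trg B M = Src B N; Trg B N = Src B P\<rbrakk>
    \<Longrightarrow> arrow B (tassoc B M N P)"
  by (simp add: tiso_arrow)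

lemma tassoc_natural:
  assumes "arrow B t" "arrow B s" "arrow B u"
    "Trg B (tdom t) = Src B (tdom s)" "Trg B (tdom s) = Src B (tdom u)"
  shows "tassoc B (tcod t) (tcod s) (tcod u) \<bullet> (t \<ast> s \<ast> u) =
    (t \<ast> (s \<ast> u)) \<bullet> tassoc B (tdom t) (tdom s) (tdom u)"
proof -
  have "Assoc B (tcod t) (tcod s) (tcod u) \<cdot> (tmor t \<star> tmor s \<star> tmor u) =
    (tmor t \<star> (tmor s \<star> tmor u)) \<cdot> Assoc B (tdom t) (tdom s) (tdom u)"
    using natural_isomorphism.naturality
      [OF Assoc_natural[of "Src B (tdom t)" "Trg B (tdom t)" "Trg B (tdom s)" "Trg B (tdom u)"],
        of "(tdom t, tdom s, tdom u)" "(tcod t, tcod s, tcod u)" "(tmor t, tmor s, tmor u)"]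
      assms assms(1-3)[THEN arrow_parallel(1)] assms(1-3)[THEN arrow_parallel(2)]
    by (simp add: prod_cat_def hom_cat_def arrow_def del: arrow_Ob)
  then show ?thesis
    by (simp add: tcomp_def tassoc_def thor_def)
qed

lemma tiso_tlunit [simp]: "M \<in> Ob B \<Longrightarrow> tiso B (tlunit B M)"
  using natural_isomorphism.component_iso[OF LUnit_natural[of "Src B M" "Trg B M"], of M]
  by (simp add: tiso_def hom_cat_def tlunit_def Iso_def inverse_arrows_def)

lemma tiso_trunit [simp]: "M \<in> Ob B \<Longrightarrow> tiso B (trunit B M)"
  using natural_isomorphism.component_iso[OF RUnit_natural[of "Src B M" "Trg B M"], of M]
  by (simp add: tiso_def hom_cat_def trunit_def Iso_def inverse_arrows_def)

lemma arrow_tunit [simp]: "M \<in> Ob B \<Longrightarrow> arrow B (tlunit B M)" "M \<in> Ob B \<Longrightarrow> arrow B (trunit B M)"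
  by (simp_all add: tiso_arrow)

lemma tlunit_natural:
  assumes "arrow B t"
  shows "tlunit B (tcod t) \<bullet> (tid B (Unit B (Src B (tdom t))) \<ast> t) = t \<bullet> tlunit B (tdom t)"
proof -
  have "LUnit B (tcod t) \<cdot> (Id B (Unit B (Src B (tdom t))) \<star> tmor t) = tmor t \<cdot> LUnit B (tdom t)"
    using natural_isomorphism.naturality
      [OF LUnit_natural[of "Src B (tdom t)" "Trg B (tdom t)"], of "tdom t" "tcod t" "tmor t"]
      assms arrow_parallel[OF assms]
    by (simp add: hom_cat_def arrow_def del: arrow_Ob)
  then show ?thesis
    using arrow_parallel[OF assms] by (simp add: tcomp_def tlunit_def thor_def tid_def)
qed

lemma trunit_natural:
  assumes "arrow B t"
  shows "trunit B (tcod t) \<bullet> (t \<ast> tid B (Unit B (Trg B (tdom t)))) = t \<bullet> trunit B (tdom t)"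
proof -
  have "RUnit B (tcod t) \<cdot> (tmor t \<star> Id B (Unit B (Trg B (tdom t)))) = tmor t \<cdot> RUnit B (tdom t)"
    using natural_isomorphism.naturality
      [OF RUnit_natural[of "Src B (tdom t)" "Trg B (tdom t)"], of "tdom t" "tcod t" "tmor t"]
      assms arrow_parallel[OF assms]
    by (simp add: hom_cat_def arrow_def del: arrow_Ob)
  then show ?thesis
    using arrow_parallel[OF assms] by (simp add: tcomp_def trunit_def thor_def tid_def)
qed

lemma typed_triangle:
  "\<lbrakk>M \<in> Ob B; N \<in> Ob B; Trg B M = Src B N\<rbrakk> \<Longrightarrow>
    (tid B M \<ast> tlunit B N) \<bullet> tassoc B M (Unit B (Src B N)) N = trunit B M \<ast> tid B N"
  using triangle[of M N]
  by (simp add: tcomp_def thor_def tid_def tassoc_def tlunit_def trunit_def)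

lemma typed_pentagon:
  "\<lbrakk>M \<in> Ob B; N \<in> Ob B; P \<in> Ob B; Q \<in> Ob B;
      Trg B M = Src B N; Trg B N = Src B P; Trg B P = Src B Q\<rbrakk> \<Longrightarrow>
    tassoc B M N (P \<odot> Q) \<bullet> tassoc B (M \<odot> N) P Q =
    (tid B M \<ast> tassoc B N P Q) \<bullet> tassoc B M (N \<odot> P) Q \<bullet> (tassoc B M N P \<ast> tid B Q)"
  using pentagon[of M N P Q] by (simp add: tcomp_def thor_def tid_def tassoc_def)

text \<open>
  Whiskering with a unit is faithful, being isomorphic to the identity by the unitor. This
  allows an equation to be checked after whiskering with a unit, where the triangle law applies.
\<close>

lemma unit_whisker_left_cancel:
  assumes "arrow B t" "arrow B s" "tdom t = tdom s" "tcod t = tcod s"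
    "tid B (Unit B (Src B (tdom t))) \<ast> t = tid B (Unit B (Src B (tdom t))) \<ast> s"
  shows "t = s"
  by (rule tcomp_right_cancel[of "tlunit B (tdom t)"])
    (use assms tlunit_natural[of t] tlunit_natural[of s] in simp_all)

lemma unit_whisker_right_cancel:
  assumes "arrow B t" "arrow B s" "tdom t = tdom s" "tcod t = tcod s"
    "t \<ast> tid B (Unit B (Trg B (tdom t))) = s \<ast> tid B (Unit B (Trg B (tdom t)))"
  shows "t = s"
  by (rule tcomp_right_cancel[of "trunit B (tdom t)"])
    (use assms trunit_natural[of t] trunit_natural[of s] in simp_all)

text \<open>
  Kelly's first coherence law. After whiskering with \<open>U\<close> on the left, both sides become the
  whiskering of \<open>r\<^sub>U\<close> by \<open>M\<close> and \<open>N\<close>: one by the pentagon for \<open>U, U, M, N\<close> and the triangle for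
  \<open>U, M \<odot> N\<close>, the other by the triangle for \<open>U, M\<close>.
\<close>

lemma tlunit_hcomp:
  assumes [simp]: "M \<in> Ob B" "N \<in> Ob B" "Trg B M = Src B N"
  shows "tlunit B (M \<odot> N) \<bullet> tassoc B (Unit B (Src B M)) M N = tlunit B M \<ast> tid B N"
proof -
  define U where "U = Unit B (Src B M)"
  have [simp]: "U \<in> Ob B" "Src B U = Src B M" "Trg B U = Src B M"
    and U [simp]: "Unit B (Src B M) = U"
    by (simp_all add: U_def)
  let ?a = "tassoc B U (U \<odot> M) N \<bullet> (tassoc B U U M \<ast> tid B N)"
  have "(tid B U \<ast> (tlunit B (M \<odot> N) \<bullet> tassoc B U M N)) \<bullet> ?a =
      (tid B U \<ast> tlunit B (M \<odot> N)) \<bullet> tassoc B U U (M \<odot> N) \<bullet> tassoc B (U \<odot> U) M N"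
    by (simp add: whisker_left typed_pentagon)
  also have "\<dots> = (trunit B U \<ast> (tid B M \<ast> tid B N)) \<bullet> tassoc B (U \<odot> U) M N"
    by (simp add: tcomp_tail[OF typed_triangle[of U "M \<odot> N", simplified]])
  also have "\<dots> = tassoc B U M N \<bullet> (trunit B U \<ast> tid B M \<ast> tid B N)"
    using tassoc_natural[of "trunit B U" "tid B M" "tid B N"] by simp
  also have "\<dots> = tassoc B U M N \<bullet> (tid B U \<ast> tlunit B M \<ast> tid B N) \<bullet> (tassoc B U U M \<ast> tid B N)"
    by (simp add: typed_triangle[of U M, simplified, symmetric] whisker_right)
  also have "\<dots> = (tid B U \<ast> (tlunit B M \<ast> tid B N)) \<bullet> ?a"
    by (simp add: tcomp_tail[OF tassoc_natural[of "tid B U" "tlunit B M" "tid B N", simplified]])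
  finally have "tid B U \<ast> (tlunit B (M \<odot> N) \<bullet> tassoc B U M N) = tid B U \<ast> (tlunit B M \<ast> tid B N)"
    by (rule tcomp_right_cancel[rotated -1]) simp_all
  note eq = this
  show ?thesis
    by (rule unit_whisker_left_cancel) (use eq in simp_all)
qed

text \<open>
  Kelly's second coherence law, by the mirror image of that argument: whisker with \<open>U\<close> on the right
  and use the pentagon for \<open>M, N, U, U\<close>.
\<close>

lemma trunit_hcomp:
  assumes [simp]: "M \<in> Ob B" "N \<in> Ob B" "Trg B M = Src B N"
  shows "(tid B M \<ast> trunit B N) \<bullet> tassoc B M N (Unit B (Trg B N)) = trunit B (M \<odot> N)"
proof -
  define U where "U = Unit B (Trg B N)"
  have [simp]: "U \<in> Ob B" "Src B U = Trg B N" "Trg B U = Trg B N"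
    and U [simp]: "Unit B (Trg B N) = U"
    by (simp_all add: U_def)
  let ?a = "tassoc B M (N \<odot> U) U \<bullet> (tassoc B M N U \<ast> tid B U)"
  have "tassoc B M N U \<bullet> (((tid B M \<ast> trunit B N) \<bullet> tassoc B M N U) \<ast> tid B U) =
      (tid B M \<ast> (trunit B N \<ast> tid B U)) \<bullet> ?a"
    by (simp add: whisker_right
      tcomp_tail[OF tassoc_natural[of "tid B M" "trunit B N" "tid B U", simplified]])
  also have "\<dots> = (tid B M \<ast> (tid B N \<ast> tlunit B U)) \<bullet> (tid B M \<ast> tassoc B N U U) \<bullet> ?a"
    by (simp add: typed_triangle[of N U, simplified, symmetric] whisker_left)
  also have "\<dots> = (tid B M \<ast> (tid B N \<ast> tlunit B U)) \<bullet> tassoc B M N (U \<odot> U) \<bullet> tassoc B (M \<odot> N) U U"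
    by (simp add: typed_pentagon)
  also have "\<dots> = tassoc B M N U \<bullet> (tid B (M \<odot> N) \<ast> tlunit B U) \<bullet> tassoc B (M \<odot> N) U U"
    by (simp add: tcomp_tail[OF tassoc_natural[of "tid B M" "tid B N" "tlunit B U", simplified]])
  also have "\<dots> = tassoc B M N U \<bullet> (trunit B (M \<odot> N) \<ast> tid B U)"
    using typed_triangle[of "M \<odot> N" U] by simp
  finally have "((tid B M \<ast> trunit B N) \<bullet> tassoc B M N U) \<ast> tid B U = trunit B (M \<odot> N) \<ast> tid B U"
    by (rule tcomp_left_cancel[rotated -1]) simp_all
  note eq = this
  show ?thesis
    by (rule unit_whisker_right_cancel) (use eq in simp_all)
qed


section \<open>Moving a 1-cell past another\<close>

text \<open>
  In this section, \<open>\<sigma> : H \<odot> N \<Rightarrow> N \<odot> H'\<close> stands for one component of a twist, where \<open>H\<close> and \<open>H'\<close>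
  are endomorphisms of the source and target of \<open>N\<close>.
  The 2-cell below is \<open>\<sigma>\<close> applied in front of a further factor, \<open>H (N M) \<Rightarrow> N (H' M)\<close>.
\<close>

definition move_past :: "'m \<Rightarrow> 'm \<Rightarrow> 'm \<Rightarrow> 'm \<times> 'c \<times> 'm \<Rightarrow> 'm \<Rightarrow> 'm \<times> 'c \<times> 'm" where
  "move_past H N H' \<sigma> M = tassoc B N H' M \<bullet> (\<sigma> \<ast> tid B M) \<bullet> tinv B (tassoc B H N M)"

definition twist_cell :: "'m \<Rightarrow> 'm \<Rightarrow> 'm \<Rightarrow> 'm \<times> 'c \<times> 'm \<Rightarrow> bool" where
  "twist_cell H N H' \<sigma> \<longleftrightarrow> H \<in> Ob B \<and> N \<in> Ob B \<and> H' \<in> Ob B \<and>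
     Src B H = Src B N \<and> Trg B H = Src B N \<and> Src B H' = Trg B N \<and> Trg B H' = Trg B N \<and>
     tiso B \<sigma> \<and> tdom \<sigma> = H \<odot> N \<and> tcod \<sigma> = N \<odot> H'"

text \<open>
  The twist of a composite \<open>N \<odot> P\<close>: the 1-cell \<open>H\<close> passes \<open>N\<close> and then \<open>P\<close>.
\<close>

definition comp_twist ::
  "'m \<Rightarrow> 'm \<Rightarrow> 'm \<Rightarrow> 'm \<Rightarrow> 'm \<Rightarrow> 'm \<times> 'c \<times> 'm \<Rightarrow> 'm \<times> 'c \<times> 'm \<Rightarrow> 'm \<times> 'c \<times> 'm" where
  "comp_twist H N H' P H'' \<sigma> \<omega> =
     tinv B (tassoc B N P H'') \<bullet> (tid B N \<ast> \<omega>) \<bullet> move_past H N H' \<sigma> P"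

lemma twist_cellD:
  assumes "twist_cell H N H' \<sigma>"
  shows "H \<in> Ob B" "N \<in> Ob B" "H' \<in> Ob B" "Src B H = Src B N" "Trg B H = Src B N"
    "Src B H' = Trg B N" "Trg B H' = Trg B N"
    "tiso B \<sigma>" "arrow B \<sigma>" "tdom \<sigma> = H \<odot> N" "tcod \<sigma> = N \<odot> H'"
  using assms by (simp_all add: twist_cell_def tiso_arrow)

lemma move_past_typing:
  assumes "twist_cell H N H' \<sigma>" "M \<in> Ob B" "Trg B N = Src B M"
  shows "tdom (move_past H N H' \<sigma> M) = H \<odot> (N \<odot> M)" "tcod (move_past H N H' \<sigma> M) = N \<odot> (H' \<odot> M)"
    "tiso B (move_past H N H' \<sigma> M)" "arrow B (move_past H N H' \<sigma> M)"
  using assms(2,3) twist_cellD[OF assms(1)] by (simp_all add: move_past_def tiso_arrow)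

lemma twist_cell_comp:
  assumes "twist_cell H N H' \<sigma>" "twist_cell H' P H'' \<omega>" "Trg B N = Src B P"
  shows "twist_cell H (N \<odot> P) H'' (comp_twist H N H' P H'' \<sigma> \<omega>)"
  using assms(3) twist_cellD[OF assms(1)] twist_cellD[OF assms(2)]
  by (simp add: twist_cell_def comp_twist_def move_past_def)

lemma move_past_natural:
  assumes "twist_cell H N H' \<sigma>" "twist_cell H N' H' \<sigma>'" "arrow B f" "tdom f = N" "tcod f = N'"
    and eq: "\<sigma>' \<bullet> (tid B H \<ast> f) = (f \<ast> tid B H') \<bullet> \<sigma>"
    and k: "arrow B k" "Src B (tdom k) = Trg B N"
  shows "move_past H N' H' \<sigma>' (tcod k) \<bullet> (tid B H \<ast> (f \<ast> k)) =
    (f \<ast> (tid B H' \<ast> k)) \<bullet> move_past H N H' \<sigma> (tdom k)"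
proof -
  note [simp] = assms(3-5) k twist_cellD[OF assms(1)] 
  have [simp]: "N' \<in> Ob B" "Src B N' = Src B N" "Trg B N' = Trg B N" "arrow B \<sigma>'" "tiso B \<sigma>'"
    "tdom \<sigma>' = H \<odot> N'" "tcod \<sigma>' = N' \<odot> H'" "Src B (tcod k) = Trg B N"
    using twist_cellD[OF assms(2)] arrow_parallel[of f] arrow_parallel[of k] by simp_all
  have "(move_past H N' H' \<sigma>' (tcod k) \<bullet> (tid B H \<ast> (f \<ast> k))) \<bullet> tassoc B H N (tdom k) =
      tassoc B N' H' (tcod k) \<bullet> (\<sigma>' \<ast> tid B (tcod k)) \<bullet> (tid B H \<ast> f \<ast> k)"
    by (simp add: move_past_def tassoc_natural[of "tid B H" f k, simplified, symmetric])
  also have "\<dots> = tassoc B N' H' (tcod k) \<bullet> (f \<ast> tid B H' \<ast> k) \<bullet> (\<sigma> \<ast> tid B (tdom k))"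
    by (simp add: interchange eq)
  also have "\<dots> = ((f \<ast> (tid B H' \<ast> k)) \<bullet> move_past H N H' \<sigma> (tdom k)) \<bullet> tassoc B H N (tdom k)"
    by (simp add: move_past_def tcomp_tail[OF tassoc_natural[of f "tid B H'" k, simplified]])
  finally show ?thesis
    by (rule tcomp_right_cancel[rotated -1]) (simp_all add: move_past_typing assms(1,2))
qed

text \<open>
  Passing \<open>P\<close> in front of \<open>M \<odot> N\<close> is passing it in front of \<open>M\<close>, with \<open>N\<close> as a bystander. The
  proof uses the pentagons for \<open>H, P, M, N\<close> and \<open>P, H', M, N\<close>, and the naturality of the associator
  at \<open>\<omega>\<close> between them.
\<close>

lemma move_past_whisker:
  assumes "twist_cell H P H' \<omega>" and [simp]: "M \<in> Ob B" "N \<in> Ob B" "Trg B P = Src B M" "Trg B M = Src B N"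
  shows "move_past H P H' \<omega> (M \<odot> N) \<bullet> (tid B H \<ast> tassoc B P M N) \<bullet> tassoc B H (P \<odot> M) N =
    (tid B P \<ast> tassoc B H' M N) \<bullet> tassoc B P (H' \<odot> M) N \<bullet> (move_past H P H' \<omega> M \<ast> tid B N)"
    (is "?l = ?r")
proof (rule tcomp_right_cancel[of "tassoc B H P M \<ast> tid B N"])
  note [simp] = twist_cellD[OF assms(1)]
  have "?l \<bullet> (tassoc B H P M \<ast> tid B N) =
      tassoc B P H' (M \<odot> N) \<bullet> (\<omega> \<ast> (tid B M \<ast> tid B N)) \<bullet> tassoc B (H \<odot> P) M N"
    by (simp add: move_past_def typed_pentagon[of H P M N, simplified, symmetric])
  also have "\<dots> = tassoc B P H' (M \<odot> N) \<bullet> tassoc B (P \<odot> H') M N \<bullet> (\<omega> \<ast> tid B M \<ast> tid B N)"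
    using tassoc_natural[of \<omega> "tid B M" "tid B N"] by simp
  also have "\<dots> = ?r \<bullet> (tassoc B H P M \<ast> tid B N)"
    by (simp add: move_past_def whisker_right tcomp_tail[OF typed_pentagon[of P H' M N, simplified]])
  finally show "?l \<bullet> (tassoc B H P M \<ast> tid B N) = ?r \<bullet> (tassoc B H P M \<ast> tid B N)" .
qed (use twist_cellD[OF assms(1)] in \<open>simp_all add: move_past_typing[OF assms(1)]\<close>)

text \<open>
  Passing \<open>N \<odot> P\<close> is passing \<open>N\<close> and then \<open>P\<close>, also in front of a further factor \<open>M\<close>. The three
  pentagons are those in which \<open>H\<close>, \<open>H'\<close> and \<open>H''\<close> stand before, between and behind \<open>N\<close> and \<open>P\<close>.
\<close>

lemma move_past_comp_twist:
  assumes "twist_cell H N H' \<sigma>" "twist_cell H' P H'' \<omega>"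
    and [simp]: "M \<in> Ob B" "Trg B N = Src B P" "Trg B P = Src B M"
  shows "tassoc B N P (H'' \<odot> M) \<bullet> move_past H (N \<odot> P) H'' (comp_twist H N H' P H'' \<sigma> \<omega>) M =
    (tid B N \<ast> move_past H' P H'' \<omega> M) \<bullet> move_past H N H' \<sigma> (P \<odot> M) \<bullet> (tid B H \<ast> tassoc B N P M)"
    (is "?l = ?r")
proof (rule tcomp_right_cancel[of "tassoc B H (N \<odot> P) M \<bullet> (tassoc B H N P \<ast> tid B M)"])
  note [simp] = twist_cellD[OF assms(1)] twist_cellD[OF assms(2)]
  let ?a = "tassoc B H (N \<odot> P) M \<bullet> (tassoc B H N P \<ast> tid B M)"
  have "?l \<bullet> ?a =
      tassoc B N P (H'' \<odot> M) \<bullet> tassoc B (N \<odot> P) H'' M \<bullet> (tinv B (tassoc B N P H'') \<ast> tid B M) \<bullet>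
      (tid B N \<ast> \<omega> \<ast> tid B M) \<bullet> (tassoc B N H' P \<ast> tid B M) \<bullet> (\<sigma> \<ast> tid B P \<ast> tid B M)"
    by (simp add: move_past_def comp_twist_def whisker_right)
  also have "\<dots> = (tid B N \<ast> tassoc B P H'' M) \<bullet> tassoc B N (P \<odot> H'') M \<bullet>
      (tid B N \<ast> \<omega> \<ast> tid B M) \<bullet> (tassoc B N H' P \<ast> tid B M) \<bullet> (\<sigma> \<ast> tid B P \<ast> tid B M)"
    by (simp add: tcomp_tail[OF typed_pentagon[of N P H'' M, simplified]])
  also have "\<dots> = (tid B N \<ast> tassoc B P H'' M) \<bullet> (tid B N \<ast> (\<omega> \<ast> tid B M)) \<bullet>
      tassoc B N (H' \<odot> P) M \<bullet> (tassoc B N H' P \<ast> tid B M) \<bullet> (\<sigma> \<ast> tid B P \<ast> tid B M)"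
    by (simp add: tcomp_tail[OF tassoc_natural[of "tid B N" \<omega> "tid B M", simplified]])
  also have "\<dots> = (tid B N \<ast> move_past H' P H'' \<omega> M) \<bullet>
      tassoc B N H' (P \<odot> M) \<bullet> tassoc B (N \<odot> H') P M \<bullet> (\<sigma> \<ast> tid B P \<ast> tid B M)"
    by (simp add: move_past_def whisker_left tcomp_tail[OF typed_pentagon[of N H' P M, simplified]])
  also have "\<dots> = (tid B N \<ast> move_past H' P H'' \<omega> M) \<bullet>
      tassoc B N H' (P \<odot> M) \<bullet> (\<sigma> \<ast> tid B (P \<odot> M)) \<bullet> tassoc B (H \<odot> N) P M"
    using tassoc_natural[of \<sigma> "tid B P" "tid B M"] by simp
  also have "\<dots> = ?r \<bullet> ?a"
    by (simp add: move_past_def[of H N] move_past_typing[OF assms(2)]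
      typed_pentagon[of H N P M, simplified, symmetric])
  finally show "?l \<bullet> ?a = ?r \<bullet> ?a" .
qed (use twist_cellD[OF assms(1)] twist_cellD[OF assms(2)] in
  \<open>simp_all add: move_past_typing assms(1,2) move_past_typing[OF twist_cell_comp[OF assms(1,2)]]\<close>)

text \<open>
  The associator is a 2-cell of twists: on both sides \<open>H\<close> passes \<open>P\<close>, \<open>M\<close> and \<open>N\<close> in this order.
\<close>

lemma comp_twist_assoc:
  assumes "twist_cell H P H' \<omega>" "twist_cell H' M H'' \<tau>" "twist_cell H'' N H''' \<nu>"
    and [simp]: "Trg B P = Src B M" "Trg B M = Src B N"
  shows "comp_twist H P H' (M \<odot> N) H''' \<omega> (comp_twist H' M H'' N H''' \<tau> \<nu>) \<bullet>
      (tid B H \<ast> tassoc B P M N) =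
    (tassoc B P M N \<ast> tid B H''') \<bullet>
      comp_twist H (P \<odot> M) H'' N H''' (comp_twist H P H' M H'' \<omega> \<tau>) \<nu>" (is "?l = ?r")
proof -
  note typing [simp] = twist_cellD[OF assms(1)] twist_cellD[OF assms(2)] twist_cellD[OF assms(3)]
    move_past_typing[OF assms(1)] move_past_typing[OF assms(2)]
    move_past_typing[OF twist_cell_comp[OF assms(1,2)]]
  let ?a = "(tid B P \<ast> tassoc B M N H''') \<bullet> tassoc B P (M \<odot> N) H'''"
  have "?a \<bullet> ?l = (tid B P \<ast> (tid B M \<ast> \<nu>)) \<bullet> (tid B P \<ast> move_past H' M H'' \<tau> N) \<bullet>
      move_past H P H' \<omega> (M \<odot> N) \<bullet> (tid B H \<ast> tassoc B P M N)"
    by (simp add: comp_twist_def whisker_left)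
  also have "\<dots> = (tid B P \<ast> (tid B M \<ast> \<nu>)) \<bullet> tassoc B P M (H'' \<odot> N) \<bullet>
      move_past H (P \<odot> M) H'' (comp_twist H P H' M H'' \<omega> \<tau>) N"
    by (simp add: move_past_comp_twist[OF assms(1,2)])
  also have "\<dots> = tassoc B P M (N \<odot> H''') \<bullet> (tid B (P \<odot> M) \<ast> \<nu>) \<bullet>
      move_past H (P \<odot> M) H'' (comp_twist H P H' M H'' \<omega> \<tau>) N"
    by (simp add: tcomp_tail[OF tassoc_natural[of "tid B P" "tid B M" \<nu>, simplified, symmetric]])
  also have "\<dots> = ?a \<bullet> ?r"
    by (simp add: comp_twist_def[of H "P \<odot> M"]
      tcomp_tail3[OF typed_pentagon[of P M N H''', simplified, symmetric]])
  finally have eq: "?a \<bullet> ?l = ?a \<bullet> ?r" .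
  note c = twist_cell_comp[OF assms(1,2)] twist_cell_comp[OF assms(2,3)]
  note [simp] = twist_cellD[OF twist_cell_comp[OF c(1) assms(3)]] twist_cellD[OF twist_cell_comp[OF assms(1) c(2)]]
  show ?thesis
    by (rule tcomp_left_cancel[OF _ _ _ _ _ eq]) simp_all
qed

lemma twist_cell_unit:
  assumes "H \<in> Ob B" "Src B H = X" "Trg B H = X"
  shows "twist_cell H (Unit B X) H (tinv B (tlunit B H) \<bullet> trunit B H)"
proof -
  have "X \<in> Cells0 B"
    using assms Src_cell by blast
  then show ?thesis
    using assms by (simp add: twist_cell_def)
qed

text \<open>
  With the twist \<open>l\<inverse> r\<close> of the unit, moving \<open>H\<close> past the unit amounts to cancelling the unit.
\<close>

lemma move_past_unit:
  assumes [simp]: "H \<in> Ob B" "Src B H = X" "Trg B H = X" "M \<in> Ob B" "Src B M = X"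
  shows "tlunit B (H \<odot> M) \<bullet> move_past H (Unit B X) H (tinv B (tlunit B H) \<bullet> trunit B H) M =
    tid B H \<ast> tlunit B M"
proof -
  have [simp]: "X \<in> Cells0 B"
    using assms Src_cell by blast
  have "tlunit B (H \<odot> M) \<bullet> move_past H (Unit B X) H (tinv B (tlunit B H) \<bullet> trunit B H) M =
      (trunit B H \<ast> tid B M) \<bullet> tinv B (tassoc B H (Unit B X) M)"
    by (simp add: move_past_def whisker_right tcomp_tail[OF tlunit_hcomp[of H M, simplified]])
  also have "\<dots> = tid B H \<ast> tlunit B M"
    by (simp add: typed_triangle[of H M, simplified, symmetric])
  finally show ?thesis .
qed

end

section \<open>Twisted cyclic isomorphisms\<close>

context shadowed_bicategory
begin

definition tsh :: "'o \<Rightarrow> 'm \<times> 'c \<times> 'm \<Rightarrow> 't \<times> 'u \<times> 't" where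
  "tsh R t = (ShOb Sh R (tdom t), ShAr Sh R (tmor t), ShOb Sh R (tcod t))"

definition tcyc :: "'m \<Rightarrow> 'm \<Rightarrow> 't \<times> 'u \<times> 't" where
  "tcyc M N = (ShOb Sh (Src B M) (M \<odot> N), cyc Sh M N, ShOb Sh (Src B N) (N \<odot> M))"

lemma tsh_simps [simp]:
  "tdom (tsh R t) = ShOb Sh R (tdom t)" "tcod (tsh R t) = ShOb Sh R (tcod t)"
  by (simp_all add: tsh_def)

lemma tcyc_simps [simp]:
  "tdom (tcyc M N) = ShOb Sh (Src B M) (M \<odot> N)" "tcod (tcyc M N) = ShOb Sh (Src B N) (N \<odot> M)"
  by (simp_all add: tcyc_def)

lemma ShOb_Ob [simp]: "\<lbrakk>M \<in> Ob B; Src B M = R; Trg B M = R\<rbrakk> \<Longrightarrow> ShOb Sh R M \<in> Ob T"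
  using cat_functor.F_ob[OF Sh_functor[of R], of M] Src_cell[of M] by (auto simp: hom_cat_def)

lemma arrow_tsh [simp]:
  assumes "arrow B t" "Src B (tdom t) = R" "Trg B (tdom t) = R"
  shows "arrow T (tsh R t)"
proof -
  have "R \<in> Cells0 B"
    using assms(1,2) Src_cell arrow_Ob by blast
  then show ?thesis
    using cat_functor.F_hom[OF Sh_functor[of R], of "tdom t" "tcod t" "tmor t"] assms
      arrow_parallel[OF assms(1)]
    by (simp add: arrow_def[of T] tsh_def hom_cat_def arrow_Hom)
qed

lemma tsh_tid [simp]:
  assumes "M \<in> Ob B" "Src B M = R" "Trg B M = R"
  shows "tsh R (tid B M) = tid T (ShOb Sh R M)"
  using cat_functor.F_Id[OF Sh_functor[of R], of M] Src_cell[of M] assms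
  by (auto simp: hom_cat_def tsh_def tid_def)

lemma tsh_tcomp:
  assumes "arrow B t" "arrow B s" "tcod s = tdom t" "Src B (tdom s) = R" "Trg B (tdom s) = R"
  shows "tsh R (t \<bullet> s) = tsh R t \<bullet>\<^bsub>T\<^esub> tsh R s"
proof -
  have "R \<in> Cells0 B"
    using assms Src_cell arrow_Ob by blast
  then have "ShAr Sh R (tmor t \<cdot> tmor s) = ShAr Sh R (tmor t) \<cdot>\<^bsub>T\<^esub> ShAr Sh R (tmor s)"
    using cat_functor.F_Comp[OF Sh_functor[of R],
      of "tdom s" "tcod s" "tcod t" "tmor s" "tmor t"] assms
      arrow_Hom[OF assms(1)] arrow_Hom[OF assms(2)]
      arrow_parallel[OF assms(1)] arrow_parallel[OF assms(2)]
    by (simp add: hom_cat_def)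
  then show ?thesis
    by (simp add: tsh_def tcomp_def)
qed

lemma tiso_tsh [simp]:
  assumes "tiso B t" "Src B (tdom t) = R" "Trg B (tdom t) = R"
  shows "tiso T (tsh R t)"
  by (rule target.tisoI[of _ "tsh R (tinv B t)"])
    (use assms tiso_arrow[OF assms(1)] arrow_parallel[of t] in \<open>simp_all flip: tsh_tcomp\<close>)

lemma tinv_tsh [simp]:
  assumes "tiso B t" "Src B (tdom t) = R" "Trg B (tdom t) = R"
  shows "tinv T (tsh R t) = tsh R (tinv B t)"
  by (rule target.tisoI)
    (use assms tiso_arrow[OF assms(1)] arrow_parallel[of t] in \<open>simp_all flip: tsh_tcomp\<close>)

lemma tiso_tcyc [simp]:
  assumes "M \<in> Ob B" "N \<in> Ob B" "Trg B M = Src B N" "Trg B N = Src B M"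
  shows "tiso T (tcyc M N)"
  using natural_isomorphism.component_iso[OF cyc_natural[of "Src B M" "Src B N"], of "(M, N)"] assms
  by (simp add: tiso_def tcyc_def prod_cat_def hom_cat_def)

lemma arrow_tcyc [simp]:
  "\<lbrakk>M \<in> Ob B; N \<in> Ob B; Trg B M = Src B N; Trg B N = Src B M\<rbrakk> \<Longrightarrow> arrow T (tcyc M N)"
  by (simp add: target.tiso_arrow)

lemma tcyc_natural:
  assumes "arrow B t" "arrow B s" "Src B (tdom t) = R" "Trg B (tdom t) = S"
    "Src B (tdom s) = S" "Trg B (tdom s) = R"
  shows "tcyc (tcod t) (tcod s) \<bullet>\<^bsub>T\<^esub> tsh R (t \<ast> s) = tsh S (s \<ast> t) \<bullet>\<^bsub>T\<^esub> tcyc (tdom t) (tdom s)"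
proof -
  note p = arrow_parallel[OF assms(1)] arrow_parallel[OF assms(2)]
  have "R \<in> Cells0 B" "S \<in> Cells0 B"
    using Src_cell[of "tdom t"] Src_cell[of "tdom s"] assms by auto
  then have "cyc Sh (tcod t) (tcod s) \<cdot>\<^bsub>T\<^esub> ShAr Sh R (tmor t \<star> tmor s) =
      ShAr Sh S (tmor s \<star> tmor t) \<cdot>\<^bsub>T\<^esub> cyc Sh (tdom t) (tdom s)"
    using natural_isomorphism.naturality[OF cyc_natural[of R S],
      of "(tdom t, tdom s)" "(tcod t, tcod s)" "(tmor t, tmor s)"] assms p
    by (simp add: hom_cat_def prod_cat_def arrow_Hom)
  then show ?thesis
    using assms p by (simp add: tsh_def tcomp_def tcyc_def thor_def)
qed

lemma tcyc_hexagon: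
  assumes "M \<in> Ob B" "N \<in> Ob B" "P \<in> Ob B"
    "Trg B M = Src B N" "Trg B N = Src B P" "Trg B P = Src B M"
  shows "tcyc (M \<odot> N) P =
    tsh (Src B P) (tassoc B P M N) \<bullet>\<^bsub>T\<^esub> tcyc N (P \<odot> M) \<bullet>\<^bsub>T\<^esub>
      tsh (Src B N) (tassoc B N P M) \<bullet>\<^bsub>T\<^esub> tcyc M (N \<odot> P) \<bullet>\<^bsub>T\<^esub> tsh (Src B M) (tassoc B M N P)"
  using cyc_hexagon[of "Src B M" "Src B N" "Src B P" M N P] assms
  by (simp add: hom_cat_def tsh_def tcomp_def tcyc_def tassoc_def)

lemma tcyc_left_unit:
  assumes "M \<in> Ob B" "Src B M = R" "Trg B M = R"
  shows "tsh R (trunit B M) \<bullet>\<^bsub>T\<^esub> tcyc (Unit B R) M = tsh R (tlunit B M)"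
proof -
  have [simp]: "R \<in> Cells0 B"
    using assms Src_cell by blast
  show ?thesis
    using cyc_left_unit[of R M] assms
    by (simp add: hom_cat_def tsh_def tcomp_def tcyc_def tlunit_def trunit_def)
qed

text \<open>
  The isomorphism \<open>c(N, M)\<close>, which takes \<open>N\<close> from the front to the back after \<open>H\<close> has passed it.
\<close>

definition fwd_cyc :: "'m \<Rightarrow> 'm \<Rightarrow> 'm \<Rightarrow> 'm \<times> 'c \<times> 'm \<Rightarrow> 'm \<Rightarrow> 't \<times> 'u \<times> 't" where
  "fwd_cyc H N H' \<sigma> M =
     tsh (Trg B N) (tassoc B H' M N) \<bullet>\<^bsub>T\<^esub> tcyc N (H' \<odot> M) \<bullet>\<^bsub>T\<^esub> tsh (Src B N) (move_past H N H' \<sigma> M)"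

lemma fwd_cyc_typing:
  assumes "twist_cell H N H' \<sigma>" "M \<in> Ob B" "Trg B N = Src B M" "Trg B M = Src B N"
  shows "tdom (fwd_cyc H N H' \<sigma> M) = ShOb Sh (Src B N) (H \<odot> (N \<odot> M))"
    "tcod (fwd_cyc H N H' \<sigma> M) = ShOb Sh (Trg B N) (H' \<odot> (M \<odot> N))"
    "tiso T (fwd_cyc H N H' \<sigma> M)" "arrow T (fwd_cyc H N H' \<sigma> M)"
proof -
  note [simp] = assms(2-4) twist_cellD[OF assms(1)] move_past_typing[OF assms(1-3)]
  show "tdom (fwd_cyc H N H' \<sigma> M) = ShOb Sh (Src B N) (H \<odot> (N \<odot> M))"
    "tcod (fwd_cyc H N H' \<sigma> M) = ShOb Sh (Trg B N) (H' \<odot> (M \<odot> N))"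
    and i: "tiso T (fwd_cyc H N H' \<sigma> M)"
    by (simp_all add: fwd_cyc_def)
  show "arrow T (fwd_cyc H N H' \<sigma> M)"
    by (rule target.tiso_arrow[OF i])
qed

lemma fwd_cyc_natural:
  assumes "twist_cell H N H' \<sigma>" "twist_cell H N' H' \<sigma>'" "arrow B f" "tdom f = N" "tcod f = N'"
    and eq: "\<sigma>' \<bullet> (tid B H \<ast> f) = (f \<ast> tid B H') \<bullet> \<sigma>"
    and k: "arrow B k" "tdom k = M" "tcod k = M'" "Src B M = Trg B N" "Trg B M = Src B N"
  shows "fwd_cyc H N' H' \<sigma>' M' \<bullet>\<^bsub>T\<^esub> tsh (Src B N) (tid B H \<ast> (f \<ast> k)) =
    tsh (Trg B N) (tid B H' \<ast> (k \<ast> f)) \<bullet>\<^bsub>T\<^esub> fwd_cyc H N H' \<sigma> M"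
proof -
  note [simp] = assms(3-5) k twist_cellD[OF assms(1)] move_past_typing[OF assms(1)] move_past_typing[OF assms(2)]
  have [simp]: "N' \<in> Ob B" "Src B N' = Src B N" "Trg B N' = Trg B N" "M \<in> Ob B" "M' \<in> Ob B"
    "Src B M' = Trg B N" "Trg B M' = Src B N"
    using twist_cellD[OF assms(2)] arrow_parallel[of f] arrow_parallel[of k]
      arrow_Ob[OF k(1)] by simp_all
  let ?R = "Trg B N" and ?S = "Src B N"
  have "fwd_cyc H N' H' \<sigma>' M' \<bullet>\<^bsub>T\<^esub> tsh ?S (tid B H \<ast> (f \<ast> k)) =
      tsh ?R (tassoc B H' M' N') \<bullet>\<^bsub>T\<^esub> tcyc N' (H' \<odot> M') \<bullet>\<^bsub>T\<^esub>
        tsh ?S (f \<ast> (tid B H' \<ast> k)) \<bullet>\<^bsub>T\<^esub> tsh ?S (move_past H N H' \<sigma> M)"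
    using move_past_natural[OF assms(1-5) eq k(1)] by (simp add: fwd_cyc_def flip: tsh_tcomp)
  also have "\<dots> = tsh ?R (tassoc B H' M' N') \<bullet>\<^bsub>T\<^esub> tsh ?R (tid B H' \<ast> k \<ast> f) \<bullet>\<^bsub>T\<^esub>
      tcyc N (H' \<odot> M) \<bullet>\<^bsub>T\<^esub> tsh ?S (move_past H N H' \<sigma> M)"
    by (simp add: target.tcomp_tail[OF tcyc_natural[of f "tid B H' \<ast> k" ?S ?R, simplified]])
  also have "\<dots> = tsh ?R (tid B H' \<ast> (k \<ast> f)) \<bullet>\<^bsub>T\<^esub> fwd_cyc H N H' \<sigma> M"
    using tassoc_natural[of "tid B H'" k f] 
    by (simp add: fwd_cyc_def flip: target.tcomp_assoc tsh_tcomp)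
  finally show ?thesis .
qed

text \<open>
  The right side takes \<open>N \<odot> P\<close> to the back in one step, the left side first \<open>N\<close> and then \<open>P\<close>. Expanding
  the cyclic isomorphism of \<open>N \<odot> P\<close> and \<open>X = H'' \<odot> M\<close> by the hexagon of the shadow yields the common
  form \<open>N P X \<rightarrow> P X N \<rightarrow> X N P\<close>. The left side is brought to it by letting \<open>H'\<close> pass \<open>P\<close> already before
  \<open>N\<close> is rotated, which the naturality of the rotation permits.
\<close>

lemma fwd_cyc_hexagon:
  assumes "twist_cell H N H' \<sigma>" "twist_cell H' P H'' \<omega>"
    and [simp]: "M \<in> Ob B" "Trg B N = Src B P" "Trg B P = Src B M" "Trg B M = Src B N"
  shows "tsh (Trg B P) (tid B H'' \<ast> tassoc B M N P) \<bullet>\<^bsub>T\<^esub> fwd_cyc H' P H'' \<omega> (M \<odot> N) \<bullet>\<^bsub>T\<^esub>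
      tsh (Src B P) (tid B H' \<ast> tassoc B P M N) \<bullet>\<^bsub>T\<^esub> fwd_cyc H N H' \<sigma> (P \<odot> M) \<bullet>\<^bsub>T\<^esub>
      tsh (Src B N) (tid B H \<ast> tassoc B N P M) =
    fwd_cyc H (N \<odot> P) H'' (comp_twist H N H' P H'' \<sigma> \<omega>) M" (is "?l = ?r")
proof -
  note [simp] = twist_cellD[OF assms(1)] twist_cellD[OF assms(2)] move_past_typing[OF assms(1)]
    move_past_typing[OF assms(2)] move_past_typing[OF twist_cell_comp[OF assms(1,2)]]
  let ?A = "Src B N" and ?B = "Src B P" and ?D = "Src B M" and ?X = "H'' \<odot> M"
  let ?\<rho> = "comp_twist H N H' P H'' \<sigma> \<omega>"
  have whisker: "tsh ?B (move_past H' P H'' \<omega> (M \<odot> N)) \<bullet>\<^bsub>T\<^esub> tsh ?B (tid B H' \<ast> tassoc B P M N) \<bullet>\<^bsub>T\<^esub>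
      tsh ?B (tassoc B H' (P \<odot> M) N) =
    tsh ?B (tid B P \<ast> tassoc B H'' M N) \<bullet>\<^bsub>T\<^esub> tsh ?B (tassoc B P ?X N) \<bullet>\<^bsub>T\<^esub>
      tsh ?B (move_past H' P H'' \<omega> M \<ast> tid B N)"
    by (simp add: move_past_whisker[OF assms(2)] flip: tsh_tcomp)
  have cyc1: "tcyc P (H'' \<odot> (M \<odot> N)) \<bullet>\<^bsub>T\<^esub> tsh ?B (tid B P \<ast> tassoc B H'' M N) =
      tsh ?D (tassoc B H'' M N \<ast> tid B P) \<bullet>\<^bsub>T\<^esub> tcyc P (?X \<odot> N)"
    using tcyc_natural[of "tid B P" "tassoc B H'' M N" ?B ?D] by simp
  have cyc2: "tsh ?B (move_past H' P H'' \<omega> M \<ast> tid B N) \<bullet>\<^bsub>T\<^esub> tcyc N (H' \<odot> (P \<odot> M)) =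
      tcyc N (P \<odot> ?X) \<bullet>\<^bsub>T\<^esub> tsh ?A (tid B N \<ast> move_past H' P H'' \<omega> M)"
    using tcyc_natural[of "tid B N" "move_past H' P H'' \<omega> M" ?A ?B] by simp
  have comp: "tsh ?A (tid B N \<ast> move_past H' P H'' \<omega> M) \<bullet>\<^bsub>T\<^esub> tsh ?A (move_past H N H' \<sigma> (P \<odot> M)) \<bullet>\<^bsub>T\<^esub>
      tsh ?A (tid B H \<ast> tassoc B N P M) =
    tsh ?A (tassoc B N P ?X) \<bullet>\<^bsub>T\<^esub> tsh ?A (move_past H (N \<odot> P) H'' ?\<rho> M)"
    by (simp add: move_past_comp_twist[OF assms(1,2)] flip: tsh_tcomp)
  have pent: "tsh ?D (tid B H'' \<ast> tassoc B M N P) \<bullet>\<^bsub>T\<^esub> tsh ?D (tassoc B H'' (M \<odot> N) P) \<bullet>\<^bsub>T\<^esub>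
      tsh ?D (tassoc B H'' M N \<ast> tid B P) =
    tsh ?D (tassoc B H'' M (N \<odot> P)) \<bullet>\<^bsub>T\<^esub> tsh ?D (tassoc B ?X N P)"
    by (simp add: typed_pentagon flip: tsh_tcomp)
  \<comment> \<open>\<open>cyc2\<close> moves the passage past \<open>P\<close> before the rotation of \<open>N\<close>, and \<open>cyc1\<close> moves the
    regrouping of \<open>H''\<close> with \<open>M\<close> before the rotation of \<open>P\<close>.\<close>
  have "?l = tsh ?D (tassoc B H'' M (N \<odot> P)) \<bullet>\<^bsub>T\<^esub> tsh ?D (tassoc B ?X N P) \<bullet>\<^bsub>T\<^esub>
      tcyc P (?X \<odot> N) \<bullet>\<^bsub>T\<^esub> tsh ?B (tassoc B P ?X N) \<bullet>\<^bsub>T\<^esub> tcyc N (P \<odot> ?X) \<bullet>\<^bsub>T\<^esub>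
      tsh ?A (tassoc B N P ?X) \<bullet>\<^bsub>T\<^esub> tsh ?A (move_past H (N \<odot> P) H'' ?\<rho> M)"
    by (simp add: fwd_cyc_def target.tcomp_tail3[OF whisker] target.tcomp_tail[OF cyc1]
      target.tcomp_tail[OF cyc2] comp target.tcomp_tail3[OF pent])
  also have "\<dots> = ?r"
    by (simp add: fwd_cyc_def tcyc_hexagon)
  finally show ?thesis .
qed

text \<open>
  The left unit law of the shadow turns the rotation of the unit into \<open>l\<close> and \<open>r\<close>. Kelly's laws
  relate these unitors of \<open>H \<odot> M\<close> to those of \<open>M\<close>.
\<close>

lemma fwd_cyc_unit:
  assumes [simp]: "H \<in> Ob B" "Src B H = R" "Trg B H = R" "M \<in> Ob B" "Src B M = R" "Trg B M = R"
  shows "tsh R (tid B H \<ast> trunit B M) \<bullet>\<^bsub>T\<^esub>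
      fwd_cyc H (Unit B R) H (tinv B (tlunit B H) \<bullet> trunit B H) M = tsh R (tid B H \<ast> tlunit B M)"
proof -
  let ?\<sigma> = "tinv B (tlunit B H) \<bullet> trunit B H"
  have [simp]: "R \<in> Cells0 B"
    using assms Src_cell by blast
  note [simp] = move_past_typing[OF twist_cell_unit[of H R]]
  have "tsh R (tid B H \<ast> trunit B M) \<bullet>\<^bsub>T\<^esub> fwd_cyc H (Unit B R) H ?\<sigma> M =
      tsh R (trunit B (H \<odot> M)) \<bullet>\<^bsub>T\<^esub> tcyc (Unit B R) (H \<odot> M) \<bullet>\<^bsub>T\<^esub> tsh R (move_past H (Unit B R) H ?\<sigma> M)"
    using trunit_hcomp[of H M] 
    by (simp add: fwd_cyc_def flip: target.tcomp_assoc tsh_tcomp)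
  also have "\<dots> = tsh R (tlunit B (H \<odot> M)) \<bullet>\<^bsub>T\<^esub> tsh R (move_past H (Unit B R) H ?\<sigma> M)"
    by (simp add: target.tcomp_tail[OF tcyc_left_unit])
  also have "\<dots> = tsh R (tid B H \<ast> tlunit B M)"
    by (simp add: move_past_unit flip: tsh_tcomp)
  finally show ?thesis .
qed

end

section \<open>The bicategory of twists\<close>

lemma category_prod_cat:
  assumes "category C" "category D"
  shows "category (prod_cat C D)"
proof -
  interpret C: category C by fact
  interpret D: category D by fact
  show ?thesis
    by unfold_locales
      (auto simp: prod_cat_def C.Id_hom D.Id_hom C.Id_left D.Id_left C.Id_right D.Id_right
        intro: C.Comp_hom D.Comp_hom C.Comp_assoc D.Comp_assoc)
qed

lemma cat_functor_swap:
  assumes "cat_functor (prod_cat C D) E (\<lambda>(x, y). Fo x y) (\<lambda>(p, q). Fa p q)"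
    and "category (prod_cat D C)"
  shows "cat_functor (prod_cat D C) E (\<lambda>(y, x). Fo x y) (\<lambda>(q, p). Fa p q)"
proof -
  interpret F: cat_functor "prod_cat C D" E "\<lambda>(x, y). Fo x y" "\<lambda>(p, q). Fa p q" by fact
  interpret P: category "prod_cat D C" by fact
  show ?thesis
  proof unfold_locales
    fix a assume "a \<in> Ob (prod_cat D C)"
    then show "(case a of (y, x) \<Rightarrow> Fo x y) \<in> Ob E"
      "(case Id (prod_cat D C) a of (q, p) \<Rightarrow> Fa p q) = Id E (case a of (y, x) \<Rightarrow> Fo x y)"
      using F.F_ob[of "prod.swap a"] F.F_Id[of "prod.swap a"] by (auto simp: prod_cat_def)
  next
    fix a b f assume "a \<in> Ob (prod_cat D C)" "b \<in> Ob (prod_cat D C)" "f \<in> Hom (prod_cat D C) a b"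
    then show "(case f of (q, p) \<Rightarrow> Fa p q) \<in>
        Hom E (case a of (y, x) \<Rightarrow> Fo x y) (case b of (y, x) \<Rightarrow> Fo x y)"
      using F.F_hom[of "prod.swap a" "prod.swap b" "prod.swap f"] by (auto simp: prod_cat_def)
  next
    fix a b c f h assume "a \<in> Ob (prod_cat D C)" "b \<in> Ob (prod_cat D C)" "c \<in> Ob (prod_cat D C)"
      "f \<in> Hom (prod_cat D C) a b" "h \<in> Hom (prod_cat D C) b c"
    then show "(case h \<cdot>\<^bsub>prod_cat D C\<^esub> f of (q, p) \<Rightarrow> Fa p q) =
        (case h of (q, p) \<Rightarrow> Fa p q) \<cdot>\<^bsub>E\<^esub> (case f of (q, p) \<Rightarrow> Fa p q)"
      using F.F_Comp[of "prod.swap a" "prod.swap b" "prod.swap c" "prod.swap f" "prod.swap h"]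
      by (auto simp: prod_cat_def)
  qed
qed

lemma category_hom_cat:
  assumes "category B"
  shows "category (hom_cat B X Y)"
proof -
  interpret category B by fact
  show ?thesis
    by unfold_locales
      (auto simp: hom_cat_def Id_hom Id_left Id_right intro: Comp_hom Comp_assoc)
qed

context twisting_data
begin

abbreviation "W \<equiv> twist_bicat B G \<Theta>"

lemma W_simps:
  "Ob W = {(M, \<tau>). twisted_cell1 B G \<Theta> M \<tau>}" "Hom W = twisted_cell2 B G \<Theta>"
  "Id W = (\<lambda>M. Id B (fst M))" "Comp W = Comp B" "Cells0 W = Cells0 B"
  "Src W = (\<lambda>M. Src B (fst M))" "Trg W = (\<lambda>M. Trg B (fst M))"
  "HComp1 W = twisted_comp B G \<Theta>" "HComp2 W = HComp2 B"
  "Assoc W = (\<lambda>M N P. Assoc B (fst M) (fst N) (fst P))"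
  "LUnit W = (\<lambda>M. LUnit B (fst M))" "RUnit W = (\<lambda>M. RUnit B (fst M))"
  "fst (Unit W X) = Unit B X"
  by (auto simp: twist_bicat_def fun_eq_iff)

lemma fst_twisted_comp [simp]: "fst (twisted_comp B G \<Theta> M N) = fst M \<odot>\<^bsub>B\<^esub> fst N"
  by (simp add: twisted_comp_def split_def)

lemma Tw_simps [simp]:
  assumes "X \<in> Cells0 B" "h \<in> carrier G"
  shows "Tw \<Theta> X h \<in> Ob B" "Src B (Tw \<Theta> X h) = X" "Trg B (Tw \<Theta> X h) = X"
  using Tw_Pic[OF assms] by (simp_all add: Pic_ob_def Ob_hom_cat)

text \<open>
  The component at \<open>h\<close> of the twist of a 1-cell, as a typed 2-cell.
\<close>

definition tcell :: "'m \<times> ('g \<Rightarrow> 'c) \<Rightarrow> 'g \<Rightarrow> 'm \<times> 'c \<times> 'm" where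
  "tcell M h = (Tw \<Theta> (Src B (fst M)) h \<odot>\<^bsub>B\<^esub> fst M, snd M h, fst M \<odot>\<^bsub>B\<^esub> Tw \<Theta> (Trg B (fst M)) h)"

lemma tcell_simps [simp]:
  "tdom (tcell M h) = Tw \<Theta> (Src B (fst M)) h \<odot>\<^bsub>B\<^esub> fst M"
  "tcod (tcell M h) = fst M \<odot>\<^bsub>B\<^esub> Tw \<Theta> (Trg B (fst M)) h"
  by (simp_all add: tcell_def)

lemma Ob_W:
  assumes "M \<in> Ob W"
  shows "fst M \<in> Ob B"
    and "h \<in> carrier G \<Longrightarrow>
      twist_cell (Tw \<Theta> (Src B (fst M)) h) (fst M) (Tw \<Theta> (Trg B (fst M)) h) (tcell M h)"
proof -
  show M: "fst M \<in> Ob B"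
    using assms by (auto simp: W_simps twisted_cell1_def Let_def)
  assume h: "h \<in> carrier G"
  then have "snd M h \<in> Iso B (Tw \<Theta> (Src B (fst M)) h \<odot>\<^bsub>B\<^esub> fst M) (fst M \<odot>\<^bsub>B\<^esub> Tw \<Theta> (Trg B (fst M)) h)"
    using assms by (auto simp: W_simps twisted_cell1_def Let_def)
  then show "twist_cell (Tw \<Theta> (Src B (fst M)) h) (fst M) (Tw \<Theta> (Trg B (fst M)) h) (tcell M h)"
    using M h by (simp add: twist_cell_def tiso_def tcell_def)
qed

lemma tcell_twisted_comp:
  assumes "fst M \<in> Ob B" "fst N \<in> Ob B" "Trg B (fst M) = Src B (fst N)" "h \<in> carrier G"
  shows "tcell (twisted_comp B G \<Theta> M N) h =
    comp_twist (Tw \<Theta> (Src B (fst M)) h) (fst M) (Tw \<Theta> (Trg B (fst M)) h)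
      (fst N) (Tw \<Theta> (Trg B (fst N)) h) (tcell M h) (tcell N h)"
  using assms
  by (simp add: tcell_def comp_twist_def move_past_def twisted_comp_def split_def InvAssoc_def
    tcomp_def tid_def tinv_def tassoc_def thor_def)

lemma tcell_Unit:
  assumes "X \<in> Cells0 B" "h \<in> carrier G"
  shows "tcell (Unit W X) h = tinv B (tlunit B (Tw \<Theta> X h)) \<bullet>\<^bsub>B\<^esub> trunit B (Tw \<Theta> X h)"
  using assms
  by (simp add: tcell_def twist_bicat_def InvLUnit_def tcomp_def tinv_def tlunit_def trunit_def)

abbreviation arr2 :: "'m \<times> ('g \<Rightarrow> 'c) \<Rightarrow> 'c \<Rightarrow> 'm \<times> ('g \<Rightarrow> 'c) \<Rightarrow> 'm \<times> 'c \<times> 'm" where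
  "arr2 M f N \<equiv> (fst M, f, fst N)"

lemma Hom_W_iff:
  assumes "fst M \<in> Ob B" "fst N \<in> Ob B"
  shows "f \<in> Hom W M N \<longleftrightarrow> arrow B (arr2 M f N) \<and>
    (\<forall>h\<in>carrier G. tcell N h \<bullet>\<^bsub>B\<^esub> (tid B (Tw \<Theta> (Src B (fst M)) h) \<ast>\<^bsub>B\<^esub> arr2 M f N) =
      (arr2 M f N \<ast>\<^bsub>B\<^esub> tid B (Tw \<Theta> (Trg B (fst M)) h)) \<bullet>\<^bsub>B\<^esub> tcell M h)"
  using assms parallel[of "fst M" "fst N" f]
  by (auto simp: W_simps twisted_cell2_def split_def arrow_def tcell_def tcomp_def thor_def tid_def)

lemma Hom_W:
  assumes "M \<in> Ob W" "N \<in> Ob W" "f \<in> Hom W M N"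
  shows "arrow B (arr2 M f N)" "Src B (fst N) = Src B (fst M)" "Trg B (fst N) = Trg B (fst M)"
    and "h \<in> carrier G \<Longrightarrow> tcell N h \<bullet>\<^bsub>B\<^esub> (tid B (Tw \<Theta> (Src B (fst M)) h) \<ast>\<^bsub>B\<^esub> arr2 M f N) =
      (arr2 M f N \<ast>\<^bsub>B\<^esub> tid B (Tw \<Theta> (Trg B (fst M)) h)) \<bullet>\<^bsub>B\<^esub> tcell M h"
  using assms Hom_W_iff[of M N f] arrow_parallel[of "arr2 M f N"] by (auto simp: Ob_W)

lemma category_W: "category W"
proof
  fix M assume M: "M \<in> Ob W"
  have "arr2 M (Id W M) M = tid B (fst M)"
    by (simp add: W_simps tid_def)
  then show "Id W M \<in> Hom W M M"
    using Ob_W(1)[OF M] twist_cellD[OF Ob_W(2)[OF M]] by (simp add: Hom_W_iff)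
next
  fix M N P f k
  assume obs: "M \<in> Ob W" "N \<in> Ob W" "P \<in> Ob W" and f: "f \<in> Hom W M N" and k: "k \<in> Hom W N P"
  let ?f = "arr2 M f N" and ?k = "arr2 N k P"
  note [simp] = Ob_W(1)[OF obs(1)] Ob_W(1)[OF obs(2)] Ob_W(1)[OF obs(3)]
    Hom_W(1-3)[OF obs(1,2) f] Hom_W(1-3)[OF obs(2,3) k]
  have fk: "arr2 M (k \<cdot>\<^bsub>B\<^esub> f) P = ?k \<bullet>\<^bsub>B\<^esub> ?f"
    by (simp add: tcomp_def)
  have "tcell P h \<bullet>\<^bsub>B\<^esub> (tid B (Tw \<Theta> (Src B (fst M)) h) \<ast>\<^bsub>B\<^esub> (?k \<bullet>\<^bsub>B\<^esub> ?f)) =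
      ((?k \<bullet>\<^bsub>B\<^esub> ?f) \<ast>\<^bsub>B\<^esub> tid B (Tw \<Theta> (Trg B (fst M)) h)) \<bullet>\<^bsub>B\<^esub> tcell M h"
    if h: "h \<in> carrier G" for h
    using h twist_cellD[OF Ob_W(2)[OF obs(1) h]] twist_cellD[OF Ob_W(2)[OF obs(2) h]]
      twist_cellD[OF Ob_W(2)[OF obs(3) h]]
    by (simp add: whisker_left whisker_right Hom_W(4)[OF obs(1,2) f h]
      tcomp_tail[OF Hom_W(4)[OF obs(2,3) k h, simplified]])
  then show "k \<cdot>\<^bsub>W\<^esub> f \<in> Hom W M P"
    by (simp add: Hom_W_iff W_simps(4) fk)
next
  fix M N f assume obs: "M \<in> Ob W" "N \<in> Ob W" and "f \<in> Hom W M N"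
  then show "Id W N \<cdot>\<^bsub>W\<^esub> f = f" "f \<cdot>\<^bsub>W\<^esub> Id W M = f"
    using Hom_W(1)[of M N f] Ob_W(1)[of M] Ob_W(1)[of N] 
      Id_left[of "fst M" "fst N" f] Id_right[of "fst M" "fst N" f]
      arrow_Hom[of "arr2 M f N"]
    by (simp_all add: W_simps(3,4))
next
  fix L M N P f k l
  assume "L \<in> Ob W" "M \<in> Ob W" "N \<in> Ob W" "P \<in> Ob W" 
    "f \<in> Hom W L M" "k \<in> Hom W M N" "l \<in> Hom W N P"
  then show "(l \<cdot>\<^bsub>W\<^esub> k) \<cdot>\<^bsub>W\<^esub> f = l \<cdot>\<^bsub>W\<^esub> k \<cdot>\<^bsub>W\<^esub> f"
    using arrow_Hom[OF Hom_W(1)[of L M f]] arrow_Hom[OF Hom_W(1)[of M N k]]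
      arrow_Hom[OF Hom_W(1)[of N P l]] Ob_W(1)
    by (simp add: W_simps(4) Comp_assoc[of "fst L" "fst M" "fst N" "fst P"])
qed

text \<open>
  The inverse in the bicategory of twists is an inverse below, so there is at most one. That the
  inverse below is a 2-cell of twists follows by inverting the square for the associator.
\<close>

lemma InvAssoc_W:
  assumes obs: "P \<in> Ob W" "M \<in> Ob W" "N \<in> Ob W"
    and [simp]: "Trg B (fst P) = Src B (fst M)" "Trg B (fst M) = Src B (fst N)"
  shows "InvAssoc W P M N = tmor (tinv B (tassoc B (fst P) (fst M) (fst N)))"
proof -
  note [simp] = Ob_W(1)[OF obs(1)] Ob_W(1)[OF obs(2)] Ob_W(1)[OF obs(3)]
  let ?L = "(P \<odot>\<^bsub>W\<^esub> M) \<odot>\<^bsub>W\<^esub> N" and ?R = "P \<odot>\<^bsub>W\<^esub> (M \<odot>\<^bsub>W\<^esub> N)"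
  let ?a = "tassoc B (fst P) (fst M) (fst N)"
  have [simp]: "fst ?L = tdom ?a" "fst ?R = tcod ?a"
    by (simp_all add: W_simps)
  have [simp]: "((fst P \<odot>\<^bsub>B\<^esub> fst M) \<odot>\<^bsub>B\<^esub> fst N, tmor ?a, fst P \<odot>\<^bsub>B\<^esub> (fst M \<odot>\<^bsub>B\<^esub> fst N)) = ?a"
    "(fst P \<odot>\<^bsub>B\<^esub> (fst M \<odot>\<^bsub>B\<^esub> fst N), tmor (tinv B ?a), (fst P \<odot>\<^bsub>B\<^esub> fst M) \<odot>\<^bsub>B\<^esub> fst N) = tinv B ?a"
    by (auto intro: typed_eqI)
  have nat: "tcell ?R h \<bullet>\<^bsub>B\<^esub> (tid B (Tw \<Theta> (Src B (fst P)) h) \<ast>\<^bsub>B\<^esub> ?a) =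
      (?a \<ast>\<^bsub>B\<^esub> tid B (Tw \<Theta> (Trg B (fst N)) h)) \<bullet>\<^bsub>B\<^esub> tcell ?L h"
    and tw: "arrow B (tcell ?L h)" "arrow B (tcell ?R h)" if h: "h \<in> carrier G" for h
  proof -
    note t = obs[THEN Ob_W(2), OF h]
    note t' = t(1) t(2)[folded assms(4)] t(3)[folded assms(5)]
    have L: "tcell ?L h = comp_twist (Tw \<Theta> (Src B (fst P)) h) (fst P \<odot>\<^bsub>B\<^esub> fst M) (Tw \<Theta> (Trg B (fst M)) h)
        (fst N) (Tw \<Theta> (Trg B (fst N)) h)
        (comp_twist (Tw \<Theta> (Src B (fst P)) h) (fst P) (Tw \<Theta> (Trg B (fst P)) h)
          (fst M) (Tw \<Theta> (Trg B (fst M)) h) (tcell P h) (tcell M h)) (tcell N h)"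
      using h by (simp add: W_simps(8) tcell_twisted_comp)
    have R: "tcell ?R h = comp_twist (Tw \<Theta> (Src B (fst P)) h) (fst P) (Tw \<Theta> (Trg B (fst P)) h)
        (fst M \<odot>\<^bsub>B\<^esub> fst N) (Tw \<Theta> (Trg B (fst N)) h) (tcell P h)
        (comp_twist (Tw \<Theta> (Trg B (fst P)) h) (fst M) (Tw \<Theta> (Trg B (fst M)) h)
          (fst N) (Tw \<Theta> (Trg B (fst N)) h) (tcell M h) (tcell N h))"
      using h by (simp add: W_simps(8) tcell_twisted_comp)
    show "tcell ?R h \<bullet>\<^bsub>B\<^esub> (tid B (Tw \<Theta> (Src B (fst P)) h) \<ast>\<^bsub>B\<^esub> ?a) =
        (?a \<ast>\<^bsub>B\<^esub> tid B (Tw \<Theta> (Trg B (fst N)) h)) \<bullet>\<^bsub>B\<^esub> tcell ?L h"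
      unfolding L R by (rule comp_twist_assoc) (use t' in simp_all)
    show "arrow B (tcell ?L h)"
      unfolding L by (rule twist_cellD(9)[OF twist_cell_comp[OF twist_cell_comp]]) (use t' in simp_all)
    show "arrow B (tcell ?R h)"
      unfolding R by (rule twist_cellD(9)[OF twist_cell_comp[OF _ twist_cell_comp]]) (use t' in simp_all)
  qed
  have nat': "tcell ?L h \<bullet>\<^bsub>B\<^esub> (tid B (Tw \<Theta> (Src B (fst P)) h) \<ast>\<^bsub>B\<^esub> tinv B ?a) =
      (tinv B ?a \<ast>\<^bsub>B\<^esub> tid B (Tw \<Theta> (Trg B (fst N)) h)) \<bullet>\<^bsub>B\<^esub> tcell ?R h" if h: "h \<in> carrier G" for h
    using tinv_square[OF nat[OF h, symmetric]] h tw[OF h] by (simp add: W_simps(8))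
  have hom: "tmor ?a \<in> Hom W ?L ?R" "tmor (tinv B ?a) \<in> Hom W ?R ?L"
    using nat nat' by (simp_all add: Hom_W_iff)
  have "inverse_arrows W ?L ?R (tmor ?a) (tmor (tinv B ?a))"
    using hom inverse_arrows_tinv[of ?a] by (simp add: inverse_arrows_def W_simps(3,4))
  moreover have "k = tmor (tinv B ?a)" if "inverse_arrows W ?L ?R (tmor ?a) k" for k
  proof -
    have "inverse_arrows B (tdom ?a) (tcod ?a) (tmor ?a) k"
      using that arrow_Hom[of ?a] arrow_Hom[of "(tcod ?a, k, tdom ?a)"]
      by (simp add: inverse_arrows_def W_simps(3,4) Hom_W_iff)
    then show ?thesis
      using Inv_eqI[of "tdom ?a" "tcod ?a"] by (simp add: tmor_simps(3))
  qed
  ultimately have "Inv W ?L ?R (tmor ?a) = tmor (tinv B ?a)"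
    unfolding Inv_def by (rule the_equality)
  then show ?thesis
    by (simp add: InvAssoc_def W_simps(10) Assoc_eq)
qed

end

locale twisted_shadow = shadowed_bicategory B T Sh + twisting_data B G \<Theta>
  for B :: "('o, 'm, 'c, 'z) bicat_scheme"
    and T :: "('t, 'u, 'y) cat_scheme"
    and Sh :: "('o, 'm, 'c, 't, 'u) shadow"
    and G :: "('g, 'x) monoid_scheme" (structure)
    and \<Theta> :: "('o, 'g, 'm, 'c) twisting" +
  fixes g :: 'g
  assumes g: "g \<in> carrier G"
begin

abbreviation "shOb \<equiv> twisted_ShOb B G \<Theta> Sh g"
abbreviation "shAr \<equiv> twisted_ShAr B G \<Theta> Sh g"

abbreviation "H X \<equiv> Tw \<Theta> X (inv g)"

lemma inv_g [simp]: "inv g \<in> carrier G"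
  using g by simp

lemma shOb_eq: "shOb R M = ShOb Sh R (H R \<odot>\<^bsub>B\<^esub> fst M)"
  by (simp add: twisted_ShOb_def left_twist1_def split_def)

lemma shAr_eq: "shAr R (tmor t) = tmor (tsh R (tid B (H R) \<ast>\<^bsub>B\<^esub> t))"
  by (simp add: twisted_ShAr_def left_twist2_def tsh_def thor_def tid_def)

lemma twisted_shadow_comp_functor:
  assumes "R \<in> Cells0 B" "S \<in> Cells0 B"
  shows "cat_functor (prod_cat (hom_cat W R S) (hom_cat W S R)) T
    (\<lambda>(M, N). shOb R (M \<odot>\<^bsub>W\<^esub> N)) (\<lambda>(f, k). shAr R (f \<star>\<^bsub>W\<^esub> k))"
proof -
  interpret P: category "prod_cat (hom_cat W R S) (hom_cat W S R)"
    by (intro category_prod_cat category_hom_cat category_W)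
  have comp: "shAr R (tmor t \<star>\<^bsub>B\<^esub> tmor s) = tmor (tsh R (tid B (H R) \<ast>\<^bsub>B\<^esub> (t \<ast>\<^bsub>B\<^esub> s)))" for t s
    using shAr_eq[of R "t \<ast>\<^bsub>B\<^esub> s"] by (simp add: thor_def)
  show ?thesis
  proof unfold_locales
    fix x assume "x \<in> Ob (prod_cat (hom_cat W R S) (hom_cat W S R))"
    then obtain M N where [simp]: "x = (M, N)" and obs: "M \<in> Ob W" "N \<in> Ob W"
      and [simp]: "Src B (fst M) = R" "Trg B (fst M) = S" "Src B (fst N) = S" "Trg B (fst N) = R"
      by (auto simp: prod_cat_def hom_cat_def W_simps(6,7))
    note [simp] = Ob_W(1)[OF obs(1)] Ob_W(1)[OF obs(2)] assms
    show "(case x of (M, N) \<Rightarrow> shOb R (M \<odot>\<^bsub>W\<^esub> N)) \<in> Ob T"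
      by (simp add: shOb_eq W_simps(8))
    show "(case Id (prod_cat (hom_cat W R S) (hom_cat W S R)) x of (f, k) \<Rightarrow> shAr R (f \<star>\<^bsub>W\<^esub> k)) =
        Id T (case x of (M, N) \<Rightarrow> shOb R (M \<odot>\<^bsub>W\<^esub> N))"
      using comp[of "tid B (fst M)" "tid B (fst N)"]
      by (simp add: prod_cat_def hom_cat_def W_simps(3,8,9) shOb_eq tmor_simps(1))
  next
    fix x y p assume "x \<in> Ob (prod_cat (hom_cat W R S) (hom_cat W S R))"
      "y \<in> Ob (prod_cat (hom_cat W R S) (hom_cat W S R))"
      "p \<in> Hom (prod_cat (hom_cat W R S) (hom_cat W S R)) x y"
    then obtain M N M' N' f k where [simp]: "x = (M, N)" "y = (M', N')" "p = (f, k)"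
      and obs: "M \<in> Ob W" "N \<in> Ob W" "M' \<in> Ob W" "N' \<in> Ob W"
      and f: "f \<in> Hom W M M'" and k: "k \<in> Hom W N N'"
      and [simp]: "Src B (fst M) = R" "Trg B (fst M) = S" "Src B (fst N) = S" "Trg B (fst N) = R"
      by (auto simp: prod_cat_def hom_cat_def W_simps(6,7))
    note [simp] = assms Hom_W(1-3)[OF obs(1,3) f] Hom_W(1-3)[OF obs(2,4) k] obs[THEN Ob_W(1)]
    show "(case p of (f, k) \<Rightarrow> shAr R (f \<star>\<^bsub>W\<^esub> k)) \<in>
        Hom T (case x of (M, N) \<Rightarrow> shOb R (M \<odot>\<^bsub>W\<^esub> N)) (case y of (M, N) \<Rightarrow> shOb R (M \<odot>\<^bsub>W\<^esub> N))"
      using target.arrow_Hom[of "tsh R (tid B (H R) \<ast>\<^bsub>B\<^esub> (arr2 M f M' \<ast>\<^bsub>B\<^esub> arr2 N k N'))"]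
        comp[of "arr2 M f M'" "arr2 N k N'"]
      by (simp add: shOb_eq W_simps(8,9))
  next
    fix x y z p q assume "x \<in> Ob (prod_cat (hom_cat W R S) (hom_cat W S R))"
      "y \<in> Ob (prod_cat (hom_cat W R S) (hom_cat W S R))"
      "z \<in> Ob (prod_cat (hom_cat W R S) (hom_cat W S R))"
      "p \<in> Hom (prod_cat (hom_cat W R S) (hom_cat W S R)) x y"
      "q \<in> Hom (prod_cat (hom_cat W R S) (hom_cat W S R)) y z"
    then obtain M N M' N' M'' N'' f k f' k'
      where [simp]: "x = (M, N)" "y = (M', N')" "z = (M'', N'')" "p = (f, k)" "q = (f', k')"
      and obs: "M \<in> Ob W" "N \<in> Ob W" "M' \<in> Ob W" "N' \<in> Ob W" "M'' \<in> Ob W" "N'' \<in> Ob W"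
      and f: "f \<in> Hom W M M'" and k: "k \<in> Hom W N N'"
      and f': "f' \<in> Hom W M' M''" and k': "k' \<in> Hom W N' N''"
      and [simp]: "Src B (fst M) = R" "Trg B (fst M) = S" "Src B (fst N) = S" "Trg B (fst N) = R"
      by (auto simp: prod_cat_def hom_cat_def W_simps(6,7))
    let ?f = "arr2 M f M'" and ?k = "arr2 N k N'" and ?f' = "arr2 M' f' M''" and ?k' = "arr2 N' k' N''"
    note [simp] = assms Hom_W(1-3)[OF obs(1,3) f] Hom_W(1-3)[OF obs(2,4) k]
      Hom_W(1-3)[OF obs(3,5) f'] Hom_W(1-3)[OF obs(4,6) k'] obs[THEN Ob_W(1)]
    have "tsh R (tid B (H R) \<ast>\<^bsub>B\<^esub> ((?f' \<bullet>\<^bsub>B\<^esub> ?f) \<ast>\<^bsub>B\<^esub> (?k' \<bullet>\<^bsub>B\<^esub> ?k))) =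
        tsh R (tid B (H R) \<ast>\<^bsub>B\<^esub> (?f' \<ast>\<^bsub>B\<^esub> ?k')) \<bullet>\<^bsub>T\<^esub> tsh R (tid B (H R) \<ast>\<^bsub>B\<^esub> (?f \<ast>\<^bsub>B\<^esub> ?k))"
      by (simp add: interchange flip: tsh_tcomp)
    from arg_cong[OF this, of tmor]
    show "(case q \<cdot>\<^bsub>prod_cat (hom_cat W R S) (hom_cat W S R)\<^esub> p of (f, k) \<Rightarrow> shAr R (f \<star>\<^bsub>W\<^esub> k)) =
        (case q of (f, k) \<Rightarrow> shAr R (f \<star>\<^bsub>W\<^esub> k)) \<cdot>\<^bsub>T\<^esub> (case p of (f, k) \<Rightarrow> shAr R (f \<star>\<^bsub>W\<^esub> k))"
      by (simp add: tmor_simps(1,2) prod_cat_def hom_cat_def W_simps(4,9) flip: comp)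
  qed
qed

text \<open>
  Of the two candidates \<open>c(M, N)\<close> and \<open>c(N, M)\<inverse>\<close>, only the second satisfies the hexagon and the
  triangle in general.
\<close>

definition twisted_cyc :: "'m \<times> ('g \<Rightarrow> 'c) \<Rightarrow> 'm \<times> ('g \<Rightarrow> 'c) \<Rightarrow> 't \<times> 'u \<times> 't" where
  "twisted_cyc M N = tinv T (fwd_cyc (H (Src B (fst N))) (fst N) (H (Trg B (fst N))) (tcell N (inv g)) (fst M))"

lemma twisted_cyc_typing:
  assumes "N \<in> Ob W" "fst M \<in> Ob B" "Trg B (fst N) = Src B (fst M)" "Trg B (fst M) = Src B (fst N)"
  shows "tdom (twisted_cyc M N) = shOb (Src B (fst M)) (M \<odot>\<^bsub>W\<^esub> N)"
    "tcod (twisted_cyc M N) = shOb (Src B (fst N)) (N \<odot>\<^bsub>W\<^esub> M)"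
    "tiso T (twisted_cyc M N)"
  using fwd_cyc_typing[OF Ob_W(2)[OF assms(1) inv_g] assms(2-)] assms
  by (simp_all add: twisted_cyc_def shOb_eq W_simps(8))

lemma twisted_cyc_natural:
  assumes "R \<in> Cells0 B" "S \<in> Cells0 B"
  shows "natural_isomorphism (prod_cat (hom_cat W R S) (hom_cat W S R)) T
    (\<lambda>(M, N). shOb R (M \<odot>\<^bsub>W\<^esub> N)) (\<lambda>(f, h). shAr R (f \<star>\<^bsub>W\<^esub> h))
    (\<lambda>(M, N). shOb S (N \<odot>\<^bsub>W\<^esub> M)) (\<lambda>(f, h). shAr S (h \<star>\<^bsub>W\<^esub> f))
    (\<lambda>(M, N). tmor (twisted_cyc M N))"
proof -
  let ?P = "prod_cat (hom_cat W R S) (hom_cat W S R)"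
  interpret F: cat_functor ?P T "\<lambda>(M, N). shOb R (M \<odot>\<^bsub>W\<^esub> N)" "\<lambda>(f, h). shAr R (f \<star>\<^bsub>W\<^esub> h)"
    by (rule twisted_shadow_comp_functor[OF assms])
  interpret F': cat_functor ?P T "\<lambda>(M, N). shOb S (N \<odot>\<^bsub>W\<^esub> M)" "\<lambda>(f, h). shAr S (h \<star>\<^bsub>W\<^esub> f)"
    by (rule cat_functor_swap[OF twisted_shadow_comp_functor[OF assms(2,1)] F.dom.category_axioms])
  show ?thesis
  proof unfold_locales
    fix x assume "x \<in> Ob ?P"
    then obtain M N where [simp]: "x = (M, N)" and obs: "M \<in> Ob W" "N \<in> Ob W"
      and [simp]: "Src B (fst M) = R" "Trg B (fst M) = S" "Src B (fst N) = S" "Trg B (fst N) = R"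
      by (auto simp: prod_cat_def hom_cat_def W_simps(6,7))
    show "(case x of (M, N) \<Rightarrow> tmor (twisted_cyc M N)) \<in>
        Iso T (case x of (M, N) \<Rightarrow> shOb R (M \<odot>\<^bsub>W\<^esub> N)) (case x of (M, N) \<Rightarrow> shOb S (N \<odot>\<^bsub>W\<^esub> M))"
      using twisted_cyc_typing[OF obs(2) Ob_W(1)[OF obs(1)]] target.tmor_tiso[of "twisted_cyc M N"] by simp
  next
    fix x y p assume "x \<in> Ob ?P" "y \<in> Ob ?P" "p \<in> Hom ?P x y"
    then obtain M N M' N' f k where [simp]: "x = (M, N)" "y = (M', N')" "p = (f, k)"
      and obs: "M \<in> Ob W" "N \<in> Ob W" "M' \<in> Ob W" "N' \<in> Ob W"
      and f: "f \<in> Hom W M M'" and k: "k \<in> Hom W N N'"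
      and [simp]: "Src B (fst M) = R" "Trg B (fst M) = S" "Src B (fst N) = S" "Trg B (fst N) = R"
      by (auto simp: prod_cat_def hom_cat_def W_simps(6,7))
    let ?f = "arr2 M f M'" and ?k = "arr2 N k N'"
    note [simp] = assms Hom_W(1-3)[OF obs(1,3) f] Hom_W(1-3)[OF obs(2,4) k] obs[THEN Ob_W(1)]
    note tw = Ob_W(2)[OF obs(2) inv_g, simplified] Ob_W(2)[OF obs(4) inv_g, simplified]
    note [simp] = fwd_cyc_typing[OF tw(1)] fwd_cyc_typing[OF tw(2)]
    have "fwd_cyc (H S) (fst N') (H R) (tcell N' (inv g)) (fst M') \<bullet>\<^bsub>T\<^esub>
        tsh S (tid B (H S) \<ast>\<^bsub>B\<^esub> (?k \<ast>\<^bsub>B\<^esub> ?f)) =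
      tsh R (tid B (H R) \<ast>\<^bsub>B\<^esub> (?f \<ast>\<^bsub>B\<^esub> ?k)) \<bullet>\<^bsub>T\<^esub>
        fwd_cyc (H S) (fst N) (H R) (tcell N (inv g)) (fst M)"
      using fwd_cyc_natural[OF tw _ _ _ Hom_W(4)[OF obs(2,4) k inv_g, simplified],
        of ?f "fst M" "fst M'"] by simp
    then have "twisted_cyc M' N' \<bullet>\<^bsub>T\<^esub> tsh R (tid B (H R) \<ast>\<^bsub>B\<^esub> (?f \<ast>\<^bsub>B\<^esub> ?k)) =
        tsh S (tid B (H S) \<ast>\<^bsub>B\<^esub> (?k \<ast>\<^bsub>B\<^esub> ?f)) \<bullet>\<^bsub>T\<^esub> twisted_cyc M N"
      unfolding twisted_cyc_def by (intro target.tinv_square[THEN trans]) simp_all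
    from arg_cong[OF this, of tmor]
    show "(case y of (M, N) \<Rightarrow> tmor (twisted_cyc M N)) \<cdot>\<^bsub>T\<^esub> (case p of (f, k) \<Rightarrow> shAr R (f \<star>\<^bsub>W\<^esub> k)) =
        (case p of (f, k) \<Rightarrow> shAr S (k \<star>\<^bsub>W\<^esub> f)) \<cdot>\<^bsub>T\<^esub> (case x of (M, N) \<Rightarrow> tmor (twisted_cyc M N))"
      using shAr_eq[of R "?f \<ast>\<^bsub>B\<^esub> ?k"] shAr_eq[of S "?k \<ast>\<^bsub>B\<^esub> ?f"]
      by (simp add: tmor_simps(2) W_simps(9) thor_def)
  qed
qed

text \<open>
  The two sides are the inverses of those of the hexagon for \<open>c\<close>, with associators brought across.
\<close>

lemma twisted_cyc_hexagon:
  assumes obs: "M \<in> Ob W" "N \<in> Ob W" "P \<in> Ob W"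
    and [simp]: "Src B (fst M) = R" "Trg B (fst M) = S" "Src B (fst N) = S" "Trg B (fst N) = Q"
      "Src B (fst P) = Q" "Trg B (fst P) = R"
  shows "tmor (twisted_cyc (P \<odot>\<^bsub>W\<^esub> M) N) \<cdot>\<^bsub>T\<^esub> shAr Q (InvAssoc W P M N) \<cdot>\<^bsub>T\<^esub> tmor (twisted_cyc (M \<odot>\<^bsub>W\<^esub> N) P) =
    shAr S (Assoc W N P M) \<cdot>\<^bsub>T\<^esub> tmor (twisted_cyc M (N \<odot>\<^bsub>W\<^esub> P)) \<cdot>\<^bsub>T\<^esub> shAr R (Assoc W M N P)"
proof -
  note [simp] = obs[THEN Ob_W(1)]
  have [simp]: "R \<in> Cells0 B" "S \<in> Cells0 B" "Q \<in> Cells0 B"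
    using Src_cell[of "fst M"] Src_cell[of "fst N"] Src_cell[of "fst P"] by simp_all
  note tw = Ob_W(2)[OF obs(2) inv_g, simplified] Ob_W(2)[OF obs(3) inv_g, simplified]
  note [simp] = fwd_cyc_typing[OF tw(1)] fwd_cyc_typing[OF tw(2)]
  let ?m = "fst M" and ?n = "fst N" and ?p = "fst P"
  \<comment> \<open>This is the hexagon for \<open>c\<close>, solved for the inverse of its one-step side.\<close>
  have NP: "twisted_cyc M (N \<odot>\<^bsub>W\<^esub> P) = tinv T
    (tsh R (tid B (H R) \<ast>\<^bsub>B\<^esub> tassoc B ?m ?n ?p) \<bullet>\<^bsub>T\<^esub>
      fwd_cyc (H Q) ?p (H R) (tcell P (inv g)) (?m \<odot>\<^bsub>B\<^esub> ?n) \<bullet>\<^bsub>T\<^esub>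
      tsh Q (tid B (H Q) \<ast>\<^bsub>B\<^esub> tassoc B ?p ?m ?n) \<bullet>\<^bsub>T\<^esub>
      fwd_cyc (H S) ?n (H Q) (tcell N (inv g)) (?p \<odot>\<^bsub>B\<^esub> ?m) \<bullet>\<^bsub>T\<^esub>
      tsh S (tid B (H S) \<ast>\<^bsub>B\<^esub> tassoc B ?n ?p ?m))"
    using fwd_cyc_hexagon[OF tw, of ?m] 
    by (simp add: twisted_cyc_def W_simps(8) tcell_twisted_comp)
  have "tmor (twisted_cyc (P \<odot>\<^bsub>W\<^esub> M) N \<bullet>\<^bsub>T\<^esub> tinv T (tsh Q (tid B (H Q) \<ast>\<^bsub>B\<^esub> tassoc B ?p ?m ?n)) \<bullet>\<^bsub>T\<^esub>
      twisted_cyc (M \<odot>\<^bsub>W\<^esub> N) P) =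
    tmor (tsh S (tid B (H S) \<ast>\<^bsub>B\<^esub> tassoc B ?n ?p ?m) \<bullet>\<^bsub>T\<^esub> twisted_cyc M (N \<odot>\<^bsub>W\<^esub> P) \<bullet>\<^bsub>T\<^esub>
      tsh R (tid B (H R) \<ast>\<^bsub>B\<^esub> tassoc B ?m ?n ?p))"
    unfolding NP
    by (simp add: twisted_cyc_def W_simps(8) target.tiso_arrow del: tinv_tsh)
  moreover have "tinv T (tsh Q (tid B (H Q) \<ast>\<^bsub>B\<^esub> tassoc B ?p ?m ?n)) =
      tsh Q (tid B (H Q) \<ast>\<^bsub>B\<^esub> tinv B (tassoc B ?p ?m ?n))"
    by simp
  ultimately show ?thesis
    by (simp add: InvAssoc_W[OF obs(3,1,2)] W_simps(10) Assoc_eq shAr_eq tmor_simps(2))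
qed

lemma twisted_cyc_unit:
  assumes "M \<in> Ob W" and [simp]: "Src B (fst M) = R" "Trg B (fst M) = R"
  shows "shAr R (LUnit W M) \<cdot>\<^bsub>T\<^esub> tmor (twisted_cyc M (Unit W R)) = shAr R (RUnit W M)"
proof -
  note [simp] = Ob_W(1)[OF assms(1)]
  have [simp]: "R \<in> Cells0 B"
    using Src_cell[of "fst M"] by simp
  let ?\<phi> = "fwd_cyc (H R) (Unit B R) (H R) (tinv B (tlunit B (H R)) \<bullet>\<^bsub>B\<^esub> trunit B (H R)) (fst M)"
  note [simp] = fwd_cyc_typing[OF twist_cell_unit[of "H R" R, simplified], of "fst M", simplified]
  have "tsh R (tid B (H R) \<ast>\<^bsub>B\<^esub> tlunit B (fst M)) \<bullet>\<^bsub>T\<^esub> tinv T ?\<phi> =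
      (tsh R (tid B (H R) \<ast>\<^bsub>B\<^esub> trunit B (fst M)) \<bullet>\<^bsub>T\<^esub> ?\<phi>) \<bullet>\<^bsub>T\<^esub> tinv T ?\<phi>"
    by (simp only: fwd_cyc_unit[of "H R" R "fst M", simplified])
  also have "\<dots> = tsh R (tid B (H R) \<ast>\<^bsub>B\<^esub> trunit B (fst M))"
    by simp
  finally have "tsh R (tid B (H R) \<ast>\<^bsub>B\<^esub> tlunit B (fst M)) \<bullet>\<^bsub>T\<^esub> twisted_cyc M (Unit W R) =
      tsh R (tid B (H R) \<ast>\<^bsub>B\<^esub> trunit B (fst M))"
    by (simp add: twisted_cyc_def W_simps(13) tcell_Unit)
  from arg_cong[OF this, of tmor] show ?thesis
    using shAr_eq[of R "tlunit B (fst M)"] shAr_eq[of R "trunit B (fst M)"]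
    by (simp add: tmor_simps(2) W_simps(11,12) tlunit_def trunit_def)
qed

end

theorem proposition4p2:
  fixes B :: "('o, 'm, 'c, 'z) bicat_scheme"
    and T :: "('t, 'u, 'y) cat_scheme"
    and Sh :: "('o, 'm, 'c, 't, 'u) shadow"
    and G :: "('g, 'x) monoid_scheme"
    and \<Theta> :: "('o, 'g, 'm, 'c) twisting"
    and g :: 'g
  assumes "shadowed_bicategory B T Sh"
    and "twisting_data B G \<Theta>"
    and "g \<in> carrier G"
  shows
    "let W = twist_bicat B G \<Theta>;
         shOb = twisted_ShOb B G \<Theta> Sh g;
         shAr = twisted_ShAr B G \<Theta> Sh g
     in \<exists>\<theta> :: 'm \<times> ('g \<Rightarrow> 'c) \<Rightarrow> 'm \<times> ('g \<Rightarrow> 'c) \<Rightarrow> 'u.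
       (\<forall>R\<in>Cells0 W. \<forall>S\<in>Cells0 W.
          natural_isomorphism (prod_cat (hom_cat W R S) (hom_cat W S R)) T
            (\<lambda>(M, N). shOb R (M \<odot>\<^bsub>W\<^esub> N)) (\<lambda>(f, h). shAr R (f \<star>\<^bsub>W\<^esub> h))
            (\<lambda>(M, N). shOb S (N \<odot>\<^bsub>W\<^esub> M)) (\<lambda>(f, h). shAr S (h \<star>\<^bsub>W\<^esub> f))
            (\<lambda>(M, N). \<theta> M N)) \<and>
       (\<forall>R\<in>Cells0 W. \<forall>S\<in>Cells0 W. \<forall>Q\<in>Cells0 W.
          \<forall>M\<in>Ob (hom_cat W R S). \<forall>N\<in>Ob (hom_cat W S Q). \<forall>P\<in>Ob (hom_cat W Q R).
            \<theta> (P \<odot>\<^bsub>W\<^esub> M) N \<cdot>\<^bsub>T\<^esub> shAr Q (InvAssoc W P M N) \<cdot>\<^bsub>T\<^esub> \<theta> (M \<odot>\<^bsub>W\<^esub> N) P =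
            shAr S (Assoc W N P M) \<cdot>\<^bsub>T\<^esub> \<theta> M (N \<odot>\<^bsub>W\<^esub> P) \<cdot>\<^bsub>T\<^esub> shAr R (Assoc W M N P)) \<and>
       (\<forall>R\<in>Cells0 W. \<forall>M\<in>Ob (hom_cat W R R).
          shAr R (LUnit W M) \<cdot>\<^bsub>T\<^esub> \<theta> M (Unit W R) = shAr R (RUnit W M))"
proof -
  interpret shadowed_bicategory B T Sh by fact
  interpret twisting_data B G \<Theta> by fact
  interpret twisted_shadow B T Sh G \<Theta> g
    by unfold_locales fact
  have "\<forall>R\<in>Cells0 W. \<forall>S\<in>Cells0 W.
      natural_isomorphism (prod_cat (hom_cat W R S) (hom_cat W S R)) T
        (\<lambda>(M, N). shOb R (M \<odot>\<^bsub>W\<^esub> N)) (\<lambda>(f, h). shAr R (f \<star>\<^bsub>W\<^esub> h))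
        (\<lambda>(M, N). shOb S (N \<odot>\<^bsub>W\<^esub> M)) (\<lambda>(f, h). shAr S (h \<star>\<^bsub>W\<^esub> f))
        (\<lambda>(M, N). tmor (twisted_cyc M N))"
    using twisted_cyc_natural by (simp add: W_simps(5))
  moreover have "\<forall>R\<in>Cells0 W. \<forall>S\<in>Cells0 W. \<forall>Q\<in>Cells0 W.
      \<forall>M\<in>Ob (hom_cat W R S). \<forall>N\<in>Ob (hom_cat W S Q). \<forall>P\<in>Ob (hom_cat W Q R).
        tmor (twisted_cyc (P \<odot>\<^bsub>W\<^esub> M) N) \<cdot>\<^bsub>T\<^esub> shAr Q (InvAssoc W P M N) \<cdot>\<^bsub>T\<^esub>
          tmor (twisted_cyc (M \<odot>\<^bsub>W\<^esub> N) P) =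
        shAr S (Assoc W N P M) \<cdot>\<^bsub>T\<^esub> tmor (twisted_cyc M (N \<odot>\<^bsub>W\<^esub> P)) \<cdot>\<^bsub>T\<^esub> shAr R (Assoc W M N P)"
    by (auto simp: hom_cat_def W_simps(6,7) intro!: twisted_cyc_hexagon)
  moreover have "\<forall>R\<in>Cells0 W. \<forall>M\<in>Ob (hom_cat W R R).
      shAr R (LUnit W M) \<cdot>\<^bsub>T\<^esub> tmor (twisted_cyc M (Unit W R)) = shAr R (RUnit W M)"
    by (auto simp: hom_cat_def W_simps(6,7) intro!: twisted_cyc_unit)
  ultimately show ?thesis
    unfolding Let_def by (intro exI[of _ "\<lambda>M N. tmor (twisted_cyc M N)"]) blast
qed

end
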